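(* Let $g:(0,\infty)\to(0,\infty)$ be a function that converges monotonically to zero, and assume that one of the following holds: (a) $g$ varies regularly at infinity with index strictly less than $-2$; or (b') the function $u\mapsto u^2g(u)$ converges monotonically to zero as $u\to\infty$. If $$\lim_{u\to\infty}\frac{\Lambda_g(u)}{\log\log u}=0,$$ then $\mathbb P$-almost surely $\limsup_{n\to\infty}\lambda_1^{(n)}/g(n)=\infty$.
   Context: Let $d\ge 2$. Let $\mathfrak E_d=\{\{x,y\}: x,y\in\mathbb Z^d,\ |x-y|_1=1\}$; write $x\sim y$ if $\{x,y\}\in\mathfrak E_d$. The environment $\boldsymbol w=(w_e)_{e\in\mathfrak E_d}$ is a family of i.i.d. $(0,\infty)$-valued random variables with law $\mathbb P$; $w$ denotes a generic copy. Let $B_n=[-n,n]^d\cap\mathbb Z^d$. For real-valued $f\in\ell^2(\mathbb Z^d)$, $\mathcal E^{\boldsymbol w}(f)=\frac12\sum_{x}\sum_{y\sim x}w_{xy}(f(x)-f(y))^2$ (the Dirichlet form of $(\mathcal L_{\boldsymbol w}f)(x)=\sum_{y\sim x}w_{xy}(f(y)-f(x))$). The principal Dirichlet eigenvalue in $B_n$ is $\lambda_1^{(n)}=\inf\{\mathcal E^{\boldsymbol w}(f): \mathrm{supp}\,f\subseteq B_n,\ \|f\|_2=1\}$. For $g:(0,\infty)\to(0,\infty)$, $\Lambda_g(u)=u^d\,\mathbb P[w\le g(u)]^{2d}$. A function varies regularly at infinity with index $\rho$ if it equals $u^\rho L(u)$ with $L(Cu)/L(u)\to1$ as $u\to\infty$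 for all $C>0$. *)

theory Defs
  imports "HOL-Probability.Probability"
begin

text \<open>The lattice Z^d is modelled as int ^ 'n with d = CARD('n).\<close>

definition l1dist :: "int ^ 'n \<Rightarrow> int ^ 'n \<Rightarrow> int" where
  "l1dist x y = (\<Sum>i\<in>UNIV. \<bar>x $ i - y $ i\<bar>)"

definition lattice_adj :: "int ^ 'n \<Rightarrow> int ^ 'n \<Rightarrow> bool" where
  "lattice_adj x y \<longleftrightarrow> l1dist x y = 1"

definition lattice_edges :: "(int ^ 'n) set set" where
  "lattice_edges = {{x, y} | x y. lattice_adj x y}"

definition box :: "nat \<Rightarrow> (int ^ 'n) set" where
  "box n = {x. \<forall>i. \<bar>x $ i\<bar> \<le> int n}"

definition dirichlet_form :: "((int ^ 'n) set \<Rightarrow> real) \<Rightarrow> (int ^ 'n \<Rightarrow> real) \<Rightarrow> real" where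
  "dirichlet_form wt f =
     (\<Sum>\<^sub>\<infinity>x. \<Sum>y\<in>{y. lattice_adj x y}. wt {x, y} * (f x - f y)^2) / 2"

definition principal_eigenvalue :: "((int ^ 'n) set \<Rightarrow> real) \<Rightarrow> nat \<Rightarrow> real" where
  "principal_eigenvalue wt n =
     Inf {dirichlet_form wt f | f. {x. f x \<noteq> 0} \<subseteq> box n \<and> (\<Sum>\<^sub>\<infinity>x. (f x)^2) = 1}"

text \<open>Lambda_g(u) = u^d P[w <= g(u)]^(2d), with mu the common law of the weights.\<close>
definition Lambda_g :: "'n itself \<Rightarrow> real measure \<Rightarrow> (real \<Rightarrow> real) \<Rightarrow> real \<Rightarrow> real" where
  "Lambda_g _ mu g u = u ^ CARD('n) * (measure mu {..g u}) ^ (2 * CARD('n))"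

definition regularly_varying :: "(real \<Rightarrow> real) \<Rightarrow> real \<Rightarrow> bool" where
  "regularly_varying g rho \<longleftrightarrow>
     (\<exists>L. (\<forall>u>0. g u = u powr rho * L u) \<and>
          (\<forall>C>0. ((\<lambda>u. L (C * u) / L u) \<longlongrightarrow> 1) at_top))"

end

theory Submission
  imports Defs "HOL-Probability.Hoeffding" "HOL-Real_Asymp.Real_Asymp"
begin

text \<open>
  Call an edge closed if its weight is at most \<open>a = K g(n)\<close> with a large constant \<open>K\<close>. Either
  hypothesis on \<open>g\<close> gives \<open>4 g(2u) \<le> g(u)\<close> eventually and \<open>u\<^sup>2 g(u) \<rightarrow> 0\<close>; hence edges are closed
  with probability about \<open>n\<^bsup>-1/2\<^esup>\<close>, and a bounded region contains at most \<open>2d\<close> closed edges.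
  If moreover no site of the box is a trap, that is, has all its \<open>2d\<close> edges closed, then every site
  is joined by boundedly many open edges to the start of a row of rectangles of fixed width \<open>m\<close>.
  Such a row is crossed along axis-parallel lines: a rectangle with fewer than \<open>m\<close> edges of weight
  at most \<open>s\<close> has a line in each direction free of them. Thus the resistance of a rectangle has
  high moments, and by Hoeffding's inequality every row to the outside of the box has resistance
  \<open>o(1 / (n g(n)))\<close>. Summing Cauchy-Schwarz along these paths bounds the eigenvalue below by
  a large multiple of \<open>g(n)\<close>.

  By a Lovasz local lemma argument the box has no trap with probability at least
  \<open>exp(- o(log log n))\<close>. Along \<open>n\<^sub>k = 2\<^bsup>k\<^sup>2\<^esup>\<close> this exceeds \<open>1/k\<close>, the events for the annuli between
  consecutive boxes are independent, and traps inside the previous box are summably rare, so both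
  Borel-Cantelli lemmas conclude.
\<close>

section \<open>Line and rectangle energies\<close>

text \<open>The obstacle is that a path out of the box has at least n edges, some of them very weak:
  the reciprocal weight of a single edge need not have enough moments. Choosing among m parallel
  lines raises the failure probability to the power m and so buys moments. A union bound over order
  n^d rows needs exponential tails, hence Hoeffding's inequality and bounded summands. This is why
  resistances are cut off at the level g(n^(1/8)): low enough that no rectangle is likely to reach
  it, high enough that the cap is a small power of n in the relevant unit 1/(n^2 g(n)). The
  inequality 4 g(2u) <= g(u) serves twice. Raising the threshold by 4^q costs only q dyadic scales,
  so the large constant K changes the trap density by a constant factor; and 1/g(2^l) is at most 4^l
  in the above unit. The n^2 in this unit has two sources: a row has about n rectangles in series,
  and an edge is shared by about n rows, boundedly many for each position in the row.\<close>

definition edge_energy :: "((int ^ 'n) \<times> 'n \<Rightarrow> real) \<Rightarrow> (int ^ 'n \<Rightarrow> real) \<Rightarrow> (int ^ 'n) \<times> 'n \<Rightarrow> real"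
  where "edge_energy W f e = W e * (f (fst e) - f (fst e + axis (snd e) 1))\<^sup>2"

text \<open>In every edge set a pair \<open>(v, k)\<close> encodes the edge from \<open>v\<close> to
  \<open>v + axis k 1\<close>, so that each unoriented edge occurs exactly once.\<close>

definition line :: "int ^ 'n \<Rightarrow> 'n \<Rightarrow> nat \<Rightarrow> ((int ^ 'n) \<times> 'n) set" where
  "line v i k = (\<lambda>l. (v + axis i (int l), i)) ` {..<k}"

text \<open>The length \<open>2 * m\<close> is twice the spacing of the corners in a row.
  Consecutive rectangles overlap in half of their length, which lets a crossing of one meet a
  crossing of the next.\<close>

definition rect :: "nat \<Rightarrow> 'n \<Rightarrow> 'n \<Rightarrow> int ^ 'n \<Rightarrow> ((int ^ 'n) \<times> 'n) set" where
  "rect m i j c = (\<lambda>(\<alpha>, \<beta>, k). (c + axis i (int \<alpha>) + axis j (int \<beta>), k)) ` ({..<2*m} \<times> {..<m} \<times> {i, j})"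

definition cube :: "nat \<Rightarrow> int ^ 'n \<Rightarrow> (int ^ 'n) set" where
  "cube r x = {u. \<forall>k. \<bar>u $ k - x $ k\<bar> \<le> int r}"

lemma axis_nth_if: "axis i x $ j = (if j = i then x else 0)"
  by (simp add: axis_def)

lemma axis_add: "axis i x + axis i y = axis i (x + y :: int)"
  by (simp add: vec_eq_iff axis_nth_if)

lemma axis_zero [simp]: "axis i 0 = 0"
  by (simp add: axis_eq_0_iff)

lemma finite_line [simp]: "finite (line v i k)"
  by (simp add: line_def)

lemma finite_rect [simp]: "finite (rect m i j c)"
  by (simp add: rect_def)

lemma card_rect_le: "card (rect m i j c) \<le> 4 * m\<^sup>2"
proof -
  have "card (rect m i j c) \<le> card ({..<2*m} \<times> {..<m} \<times> {i, j})"
    unfolding rect_def by (rule card_image_le) auto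
  also have "\<dots> = (2 * m) * (m * card {i, j})" by (simp only: card_cartesian_product card_lessThan)
  also have "\<dots> \<le> (2 * m) * (m * 2)"
    by (intro mult_left_mono) (auto simp: card_insert_if)
  finally show ?thesis by (simp add: power2_eq_square)
qed

lemma card_cube: "finite (cube r (x :: int ^ 'n))" "card (cube r (x :: int ^ 'n)) = (2 * r + 1) ^ CARD('n)"
proof -
  let ?P = "PiE (UNIV :: 'n set) (\<lambda>k. {x $ k - int r .. x $ k + int r})"
  have bij: "bij_betw (\<lambda>h. \<chi> k. h k) ?P (cube r x)"
  proof (rule bij_betw_byWitness[where f' = "\<lambda>u. ($) u"])
    show "(\<lambda>h. \<chi> k. h k) ` ?P \<subseteq> cube r x"
      by (auto simp: cube_def PiE_def Pi_def abs_le_iff algebra_simps)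
    show "($) ` cube r x \<subseteq> ?P"
      by (auto simp: cube_def abs_le_iff algebra_simps)
  qed auto
  have fin: "finite ?P" by (intro finite_PiE) auto
  from bij fin show "finite (cube r x)" using bij_betw_finite by blast
  have "card (cube r x) = card ?P" using bij bij_betw_same_card by metis
  also have "\<dots> = (\<Prod>k\<in>(UNIV :: 'n set). card {x $ k - int r .. x $ k + int r})"
    by (rule card_PiE) simp
  also have "\<dots> = (\<Prod>k\<in>(UNIV :: 'n set). 2 * r + 1)"
    by (rule prod.cong) (auto simp: nat_eq_iff)
  finally show "card (cube r x) = (2 * r + 1) ^ CARD('n)" by simp
qed

lemma box_eq_cube: "Defs.box n = cube n 0"
  by (auto simp: Defs.box_def cube_def)

lemma mem_line_iff:
  "(u, k) \<in> line v i N \<longleftrightarrow> k = i \<and> v $ i \<le> u $ i \<and> u $ i < v $ i + int N \<and> (\<forall>j. j \<noteq> i \<longrightarrow> u $ j = v $ j)"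
proof
  assume "(u, k) \<in> line v i N"
  then show "k = i \<and> v $ i \<le> u $ i \<and> u $ i < v $ i + int N \<and> (\<forall>j. j \<noteq> i \<longrightarrow> u $ j = v $ j)"
    by (auto simp: line_def axis_nth_if)
next
  assume a: "k = i \<and> v $ i \<le> u $ i \<and> u $ i < v $ i + int N \<and> (\<forall>j. j \<noteq> i \<longrightarrow> u $ j = v $ j)"
  then have "(u, k) = (v + axis i (int (nat (u $ i - v $ i))), i)" "nat (u $ i - v $ i) < N"
    by (auto simp: vec_eq_iff axis_nth_if)
  then show "(u, k) \<in> line v i N" unfolding line_def by blast
qed

text \<open>Pigeonhole: choosing one closed edge from each of the disjoint sets would inject
  \<open>L\<close> into the closed edges. Rays and crossings are all found in this way.\<close>

lemma ex_free_of_closed: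
  assumes "finite D" "card {e \<in> D. P e} < card L" "finite L"
    and "\<And>a. a \<in> L \<Longrightarrow> A a \<subseteq> D" and "disjoint_family_on A L"
  shows "\<exists>a\<in>L. \<forall>e\<in>A a. \<not> P e"
proof (rule ccontr)
  assume "\<not> ?thesis"
  then have "\<forall>a\<in>L. \<exists>e. e \<in> A a \<and> P e" by blast
  then obtain c where c: "\<And>a. a \<in> L \<Longrightarrow> c a \<in> A a \<and> P (c a)" by metis
  have "inj_on c L"
    using c assms(5) unfolding inj_on_def disjoint_family_on_def by (metis disjoint_iff)
  moreover have "c ` L \<subseteq> {e \<in> D. P e}" using c assms(4) by blast
  ultimately have "card L \<le> card {e \<in> D. P e}"
    using assms(1) by (intro card_inj_on_le[of c]) auto
  then show False using assms(2) by simp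
qed

text \<open>Resistances in series: \<open>k\<close> edges of conductance above \<open>s\<close> have
  total resistance at most \<open>k / s\<close>, and Cauchy-Schwarz along the line turns this into
  an energy bound. The energy is taken over a larger set \<open>D\<close> so that several lines can
  share one sum.\<close>

lemma line_energy_bound:
  assumes s: "s > 0" and open_line: "\<And>e. e \<in> line v i k \<Longrightarrow> W e > s"
    and sub: "line v i k \<subseteq> D" and fin: "finite D" and nonneg: "\<And>e. W e \<ge> 0"
    and ab: "a \<le> k" "b \<le> k"
  shows "(f (v + axis i (int a)) - f (v + axis i (int b)))\<^sup>2 \<le> real k / s * (\<Sum>e\<in>D. edge_energy W f e)"
  using ab
proof (induction a b rule: linorder_wlog)
  case (sym a b)
  then show ?case by (simp add: power2_commute)
next
  case (le a b)
  define \<phi> where "\<phi> l = f (v + axis i (int l))" for l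
  define en where "en l = edge_energy W f (v + axis i (int l), i)" for l
  have en: "(\<phi> l - \<phi> (Suc l))\<^sup>2 \<le> en l / s" if "l < k" for l
  proof -
    have "(v + axis i (int l), i) \<in> line v i k" using that by (auto simp: line_def)
    then have "W (v + axis i (int l), i) > s" by (rule open_line)
    then have "s * (\<phi> l - \<phi> (Suc l))\<^sup>2 \<le> W (v + axis i (int l), i) * (\<phi> l - \<phi> (Suc l))\<^sup>2"
      by (intro mult_right_mono) auto
    also have "\<dots> = en l"
      by (simp add: en_def edge_energy_def \<phi>_def add.assoc axis_add) (simp add: add.commute)
    finally show ?thesis using s by (simp add: field_simps)
  qed
  have "(\<phi> a - \<phi> b)\<^sup>2 = (\<Sum>l\<in>{a..<b}. \<phi> (Suc l) - \<phi> l)\<^sup>2"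
    using sum_Suc_diff'[OF le(1), of \<phi>] by (simp add: power2_commute)
  also have "\<dots> \<le> (\<Sum>l\<in>{a..<b}. (\<phi> (Suc l) - \<phi> l)\<^sup>2) * real (card {a..<b})"
    using sum_squared_le_sum_of_squares[of "\<lambda>l. \<phi> (Suc l) - \<phi> l" "{a..<b}"] by (cases "a = b") auto
  also have "\<dots> \<le> (\<Sum>l<k. en l / s) * real k"
  proof (intro mult_mono)
    have "(\<Sum>l\<in>{a..<b}. (\<phi> (Suc l) - \<phi> l)\<^sup>2) \<le> (\<Sum>l\<in>{a..<b}. en l / s)"
      using le en by (intro sum_mono) (auto simp: power2_commute)
    also have "\<dots> \<le> (\<Sum>l<k. en l / s)"
      using le s nonneg by (intro sum_mono2) (auto simp: en_def edge_energy_def)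
    finally show "(\<Sum>l\<in>{a..<b}. (\<phi> (Suc l) - \<phi> l)\<^sup>2) \<le> (\<Sum>l<k. en l / s)" .
  qed (use le s nonneg in \<open>auto intro!: sum_nonneg simp: en_def edge_energy_def\<close>)
  also have "(\<Sum>l<k. en l / s) * real k = real k / s * (\<Sum>l<k. en l)"
    by (simp add: sum_divide_distrib[symmetric])
  also have "(\<Sum>l<k. en l) = (\<Sum>e\<in>line v i k. edge_energy W f e)"
    unfolding line_def en_def by (subst sum.reindex) (auto simp: inj_on_def axis_eq_axis)
  also have "real k / s * (\<Sum>e\<in>line v i k. edge_energy W f e) \<le> real k / s * (\<Sum>e\<in>D. edge_energy W f e)"
    using s nonneg sub fin by (intro mult_left_mono sum_mono2) (auto simp: edge_energy_def)
  finally show ?case by (simp add: \<phi>_def)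
qed

lemma disjoint_lines:
  "k \<noteq> i \<Longrightarrow> v $ k \<noteq> v' $ k \<Longrightarrow> line v i N \<inter> line v' i N' = {}"
  by (auto simp: mem_line_iff)

lemma rect_lines:
  assumes "i \<noteq> j"
  shows "\<beta> < m \<Longrightarrow> line (c + axis j (int \<beta>)) i (2 * m) \<subseteq> rect m i j c"
    and "\<alpha> < m \<Longrightarrow> line (c + axis i (int \<alpha>)) j m \<subseteq> rect m i j c"
proof -
  assume "\<beta> < m"
  then have "(c + axis j (int \<beta>) + axis i (int l), i) \<in> rect m i j c" if "l < 2 * m" for l
    using that unfolding rect_def by (intro rev_image_eqI[of "(l, \<beta>, i)"]) (auto simp: algebra_simps)
  then show "line (c + axis j (int \<beta>)) i (2 * m) \<subseteq> rect m i j c"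
    unfolding line_def by auto
next
  assume "\<alpha> < m"
  then have "(c + axis i (int \<alpha>) + axis j (int l), j) \<in> rect m i j c" if "l < m" for l
    using that unfolding rect_def by (intro rev_image_eqI[of "(\<alpha>, l, j)"]) auto
  then show "line (c + axis i (int \<alpha>)) j m \<subseteq> rect m i j c"
    unfolding line_def by auto
qed

text \<open>Each direction offers \<open>m\<close> disjoint candidate lines, more than there are
  closed edges. Only the first \<open>m\<close> of the \<open>2 * m\<close> columns are candidates,
  so that a column of the next rectangle still lies within the span of a long line of the present
  one.\<close>

lemma rect_crossing:
  assumes "i \<noteq> j" and "card {e \<in> rect m i j c. W e \<le> s} < m"
  shows "\<exists>\<beta><m. \<forall>e \<in> line (c + axis j (int \<beta>)) i (2 * m). W e > (s :: real)"
    and "\<exists>\<alpha><m. \<forall>e \<in> line (c + axis i (int \<alpha>)) j m. W e > s"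
proof -
  have "disjoint_family_on (\<lambda>\<beta>. line (c + axis j (int \<beta>)) i (2 * m)) {..<m}"
    using assms(1) unfolding disjoint_family_on_def
    by (intro ballI impI disjoint_lines[of j]) (auto simp: axis_nth_if)
  then have "\<exists>\<beta>\<in>{..<m}. \<forall>e \<in> line (c + axis j (int \<beta>)) i (2 * m). \<not> W e \<le> s"
    using assms(2) rect_lines(1)[OF assms(1)]
    by (intro ex_free_of_closed[where D = "rect m i j c"]) simp_all
  then show "\<exists>\<beta><m. \<forall>e \<in> line (c + axis j (int \<beta>)) i (2 * m). W e > s"
    by (auto simp: not_le)
  have "disjoint_family_on (\<lambda>\<alpha>. line (c + axis i (int \<alpha>)) j m) {..<m}"
    using assms(1) unfolding disjoint_family_on_def
    by (intro ballI impI disjoint_lines[of i]) (auto simp: axis_nth_if)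
  then have "\<exists>\<alpha>\<in>{..<m}. \<forall>e \<in> line (c + axis i (int \<alpha>)) j m. \<not> W e \<le> s"
    using assms(2) rect_lines(2)[OF assms(1)]
    by (intro ex_free_of_closed[where D = "rect m i j c"]) simp_all
  then show "\<exists>\<alpha><m. \<forall>e \<in> line (c + axis i (int \<alpha>)) j m. W e > s"
    by (auto simp: not_le)
qed

section \<open>The deterministic spectral bound\<close>

text \<open>The path is a staircase: along the open long line of one rectangle to the open column of
  the next, along that column to the next long line, and so on until \<open>f\<close> vanishes. Two
  starting points are offered, on the sides of the first rectangle along \<open>i\<close> and along
  \<open>j\<close>, because a site may reach the row from either side.\<close>

lemma row_bound:
  fixes f :: "int ^ 'n \<Rightarrow> real"
  assumes ij: "i \<noteq> j" and nonneg: "\<And>e. W e \<ge> 0"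
    and level: "\<And>k. k \<le> n \<Longrightarrow> \<exists>s>0. card {e \<in> rect m i j (c + axis i (int (k * m))). W e \<le> s} < m \<and> 1 / s \<le> T k"
    and vanish: "\<And>x. x $ i \<ge> c $ i + int (n * m) \<Longrightarrow> f x = 0"
  defines "B \<equiv> 18 * real m * (\<Sum>k\<le>n. T k) * (\<Sum>k\<le>n. \<Sum>e\<in>rect m i j (c + axis i (int (k * m))). edge_energy W f e)"
  shows "\<exists>v<m. \<exists>h<m. (f (c + axis i (int v)))\<^sup>2 \<le> B \<and> (f (c + axis j (int h)))\<^sup>2 \<le> B"
proof -
  define ck where "ck k = c + axis i (int (k * m))" for k
  define E where "E k = (\<Sum>e\<in>rect m i j (ck k). edge_energy W f e)" for k
  \<comment> \<open>Bounds the change of \<open>f\<close> along one crossing of rectangle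
    \<open>k\<close>; written as a product of roots so that Cauchy-Schwarz later separates
    resistances from energies.\<close>
  define t where "t k = sqrt (2 * real m * T k) * sqrt (E k)" for k
  have E0: "E k \<ge> 0" for k
    unfolding E_def by (intro sum_nonneg) (auto simp: edge_energy_def nonneg)
  have "\<forall>k. \<exists>s v h. k \<le> n \<longrightarrow> s > 0 \<and> 1 / s \<le> T k \<and> v < m \<and> h < m \<and>
      (\<forall>e \<in> line (ck k + axis j (int h)) i (2 * m). W e > s) \<and>
      (\<forall>e \<in> line (ck k + axis i (int v)) j m. W e > s)"
  proof
    fix k
    show "\<exists>s v h. k \<le> n \<longrightarrow> s > 0 \<and> 1 / s \<le> T k \<and> v < m \<and> h < m \<and>
      (\<forall>e \<in> line (ck k + axis j (int h)) i (2 * m). W e > s) \<and>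
      (\<forall>e \<in> line (ck k + axis i (int v)) j m. W e > s)"
    proof (cases "k \<le> n")
      case True
      then obtain s where s: "s > 0" "card {e \<in> rect m i j (ck k). W e \<le> s} < m" "1 / s \<le> T k"
        using level unfolding ck_def by blast
      show ?thesis using s(1,3) rect_crossing[OF ij s(2)] by blast
    qed simp
  qed
  then obtain s v h where svh: "\<And>k. k \<le> n \<Longrightarrow> s k > 0 \<and> 1 / s k \<le> T k \<and> v k < m \<and> h k < m \<and>
      (\<forall>e \<in> line (ck k + axis j (int (h k))) i (2 * m). W e > s k) \<and>
      (\<forall>e \<in> line (ck k + axis i (int (v k))) j m. W e > s k)"
    by metis
  have T0: "T k \<ge> 0" if "k \<le> n" for k
    using svh[OF that] by (smt (verit) divide_nonneg_nonneg)
  have t0: "t k \<ge> 0" if "k \<le> n" for k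
    using E0 T0[OF that] by (simp add: t_def)
  have to_t: "\<bar>y\<bar> \<le> t k" if "k \<le> n" "y\<^sup>2 \<le> real N / s k * E k" "N \<le> 2 * m" for y k N
  proof -
    have "real N / s k * E k \<le> 2 * real m * T k * E k"
    proof (rule mult_right_mono)
      have "real N / s k = real N * (1 / s k)" by simp
      also have "\<dots> \<le> 2 * real m * T k"
        using svh[OF that(1)] that(3) by (intro mult_mono) auto
      finally show "real N / s k \<le> 2 * real m * T k" .
    qed (rule E0)
    then have "y\<^sup>2 \<le> 2 * real m * T k * E k" using that(2) by simp
    then have "sqrt (y\<^sup>2) \<le> sqrt (2 * real m * T k * E k)" by (rule real_sqrt_le_mono)
    then show ?thesis by (simp add: t_def real_sqrt_mult)
  qed
  have H: "\<bar>f (ck k + axis j (int (h k)) + axis i (int a)) - f (ck k + axis j (int (h k)) + axis i (int b))\<bar> \<le> t k"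
    if "k \<le> n" "a \<le> 2 * m" "b \<le> 2 * m" for k a b
  proof (rule to_t[OF that(1), of _ "2 * m"], unfold E_def, rule line_energy_bound)
    show "line (ck k + axis j (int (h k))) i (2 * m) \<subseteq> rect m i j (ck k)"
      using svh[OF that(1)] by (intro rect_lines[OF ij]) simp
  qed (use svh[OF that(1)] nonneg that in simp_all)
  have V: "\<bar>f (ck k + axis i (int (v k)) + axis j (int a)) - f (ck k + axis i (int (v k)) + axis j (int b))\<bar> \<le> t k"
    if "k \<le> n" "a \<le> m" "b \<le> m" for k a b
  proof (rule to_t[OF that(1), of _ m], unfold E_def, rule line_energy_bound)
    show "line (ck k + axis i (int (v k))) j (m) \<subseteq> rect m i j (ck k)"
      using svh[OF that(1)] by (intro rect_lines[OF ij]) simp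
  qed (use svh[OF that(1)] nonneg that in simp_all)
  define P where "P k = ck k + axis i (int (v k)) + axis j (int (h k))" for k
  have step: "\<bar>f (P k) - f (P (Suc k))\<bar> \<le> t k + t (Suc k)" if "Suc k \<le> n" for k
  proof -
    have k: "k \<le> n" using that by simp
    have "v k \<le> 2 * m" "m + v (Suc k) \<le> 2 * m" "h k \<le> m" "h (Suc k) \<le> m"
      using svh[OF k] svh[OF that] by auto
    note bnds = this
    have e1: "ck k + axis j (int (h k)) + axis i (int (v k)) = P k"
      by (simp add: P_def algebra_simps)
    \<comment> \<open>Corners are \<open>m\<close> apart, so column \<open>v (Suc k)\<close> of the
      next rectangle is column \<open>m + v (Suc k)\<close> of this one.\<close>
    have e2: "ck k + axis j (int (h k)) + axis i (int (m + v (Suc k))) =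
        ck (Suc k) + axis i (int (v (Suc k))) + axis j (int (h k))"
      by (auto simp: ck_def vec_eq_iff axis_nth_if algebra_simps)
    have e3: "ck (Suc k) + axis i (int (v (Suc k))) + axis j (int (h (Suc k))) = P (Suc k)"
      by (simp add: P_def)
    show ?thesis
      using H[OF k bnds(1,2), unfolded e1 e2] V[OF that bnds(3,4), unfolded e3] by linarith
  qed
  have Pn: "f (P n) = 0"
    using ij by (intro vanish) (auto simp: P_def ck_def axis_nth_if)
  have "\<bar>f (P 0)\<bar> \<le> (\<Sum>k<N. t k + t (Suc k)) + \<bar>f (P N)\<bar>" if "N \<le> n" for N
    using that by (induction N) (use step in \<open>fastforce+\<close>)
  from this[of n] have P0: "\<bar>f (P 0)\<bar> \<le> (\<Sum>k<n. t k) + (\<Sum>k<n. t (Suc k))"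
    using Pn by (simp add: sum.distrib)
  have s1: "(\<Sum>k<n. t k) \<le> (\<Sum>k\<le>n. t k)"
    by (intro sum_mono2) (auto intro: t0)
  have s2: "(\<Sum>k<n. t (Suc k)) + t 0 = (\<Sum>k\<le>n. t k)"
    using sum.atMost_shift[of t n] by simp
  have s3: "t 0 \<le> (\<Sum>k\<le>n. t k)"
    by (rule member_le_sum) (auto intro: t0)
  \<comment> \<open>Each \<open>t k\<close> is charged at most three times; the square of 3 and the
    factor \<open>2 * real m\<close> inside \<open>t\<close> produce the constant 18 in
    \<open>B\<close>.\<close>
  have fin: "y\<^sup>2 \<le> B" if y: "\<bar>y - f (P 0)\<bar> \<le> t 0" for y
  proof -
    have "\<bar>y\<bar> \<le> 3 * (\<Sum>k\<le>n. t k)" using y P0 s1 s2 s3 by linarith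
    then have "y\<^sup>2 \<le> (3 * (\<Sum>k\<le>n. t k))\<^sup>2"
      by (metis abs_ge_zero power2_abs power_mono)
    also have "\<dots> = 9 * (\<Sum>k\<le>n. t k)\<^sup>2" by (simp add: power_mult_distrib)
    also have "(\<Sum>k\<le>n. t k)\<^sup>2 \<le> (\<Sum>k\<le>n. (sqrt (2 * real m * T k))\<^sup>2) * (\<Sum>k\<le>n. (sqrt (E k))\<^sup>2)"
      unfolding t_def by (rule Cauchy_Schwarz_ineq_sum)
    also have "(\<Sum>k\<le>n. (sqrt (2 * real m * T k))\<^sup>2) = (\<Sum>k\<le>n. 2 * real m * T k)"
      using T0 by (intro sum.cong) auto
    also have "(\<Sum>k\<le>n. (sqrt (E k))\<^sup>2) = (\<Sum>k\<le>n. E k)"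
      using E0 by (intro sum.cong) auto
    finally show ?thesis
      by (simp add: B_def E_def ck_def sum_distrib_left[symmetric] mult.assoc)
  qed
  have "(f (c + axis i (int (v 0))))\<^sup>2 \<le> B"
    using V[of 0 0 "h 0"] svh[of 0] by (intro fin) (simp add: P_def ck_def)
  moreover have "(f (c + axis j (int (h 0))))\<^sup>2 \<le> B"
    using H[of 0 0 "v 0"] svh[of 0] by (intro fin) (simp add: P_def ck_def algebra_simps)
  ultimately show ?thesis using svh[of 0] by blast
qed

text \<open>Congestion bound, by exchanging the two sums: it converts the energies collected along
  the paths of all sites into a single energy sum.\<close>

lemma double_count_le:
  fixes F :: "'e \<Rightarrow> real"
  assumes "finite X" "finite S" "\<And>x. x \<in> X \<Longrightarrow> D x \<subseteq> S" "\<And>e. F e \<ge> 0"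
    and "\<And>e. e \<in> S \<Longrightarrow> card {x \<in> X. e \<in> D x} \<le> \<kappa>"
  shows "(\<Sum>x\<in>X. \<Sum>e\<in>D x. F e) \<le> real \<kappa> * (\<Sum>e\<in>S. F e)"
proof -
  have "(\<Sum>x\<in>X. \<Sum>e\<in>D x. F e) = (\<Sum>x\<in>X. \<Sum>e\<in>S. if e \<in> D x then F e else 0)"
    using assms(2,3) by (intro sum.cong[OF refl] sum.mono_neutral_cong_left) auto
  also have "\<dots> = (\<Sum>e\<in>S. \<Sum>x\<in>X. if e \<in> D x then F e else 0)" by (rule sum.swap)
  also have "\<dots> = (\<Sum>e\<in>S. real (card {x \<in> X. e \<in> D x}) * F e)"
    using assms(1) by (intro sum.cong[OF refl]) (simp add: sum.If_cases Collect_conj_eq)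
  also have "\<dots> \<le> (\<Sum>e\<in>S. real \<kappa> * F e)"
    using assms(4,5) by (intro sum_mono mult_right_mono) auto
  finally show ?thesis by (simp add: sum_distrib_left)
qed

text \<open>The edge leaving \<open>x\<close> in the positive direction \<open>i\<close> is indexed by \<open>x\<close>,
  the one leaving in the negative direction by the neighbouring site.\<close>

definition star :: "int ^ 'n \<Rightarrow> ((int ^ 'n) \<times> 'n) set" where
  "star x = (\<lambda>(\<sigma>, i). (x - (if \<sigma> then 0 else axis i 1), i)) ` UNIV"

text \<open>Two adjacent sites have \<open>4d - 2 > 2d\<close> disjoint rays leaving them, so at most \<open>2d\<close>
  closed edges cannot confine a pair of sites joined by an open edge.\<close>

lemma site_bound:
  fixes f :: "int ^ 'n \<Rightarrow> real"
  assumes dim: "CARD('n) \<ge> 2" and ij: "i \<noteq> j" and nonneg: "\<And>e. W e \<ge> 0" and a: "a > 0"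
    and m: "2 * CARD('n) \<le> m"
    and out: "\<exists>e\<in>star x. W e > a"
    and few: "card {e \<in> cube (m + 2 * CARD('n) + 1) x \<times> UNIV. W e \<le> a} \<le> 2 * CARD('n)"
    and v: "\<And>z. v z < m" and h: "\<And>z. h z < m"
  shows "\<exists>z\<in>cube (2 * CARD('n) + 1) x. \<exists>z'\<in>{z + axis i (int (v z)), z + axis j (int (h z))}.
     (f x - f z')\<^sup>2 \<le> 9 * real m / a * (\<Sum>e\<in>cube (m + 2 * CARD('n) + 1) x \<times> UNIV. edge_energy W f e)"
proof -
  define d where "d = CARD('n)"
  define D where "D = cube (m + 2 * d + 1) x \<times> (UNIV :: 'n set)"
  define E where "E = (\<Sum>e\<in>D. edge_energy W f e)"
  have finD: "finite D" by (simp add: D_def card_cube)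
  have E0: "E \<ge> 0" unfolding E_def by (intro sum_nonneg) (auto simp: edge_energy_def nonneg)
  have few': "card {e \<in> D. W e \<le> a} < 2 * d + 1" using few by (simp add: D_def d_def)
  have d2: "d \<ge> 2" and md: "2 * d \<le> m" using dim m by (auto simp: d_def)
  obtain \<sigma>0 i0 where out0: "W (x - (if \<sigma>0 then 0 else axis i0 1), i0) > a"
    using out by (auto simp: star_def)
  define y where "y = x + axis i0 (if \<sigma>0 then 1 else - 1)"
  have y_nth: "y $ k = x $ k + (if k = i0 then (if \<sigma>0 then 1 else -1) else 0)" for k
    by (auto simp: y_def axis_nth_if)
  define v0 where "v0 = x - (if \<sigma>0 then 0 else axis i0 1)"
  have xy: "(f x - f y)\<^sup>2 \<le> real 1 / a * E"
  proof -
    have "line v0 i0 1 \<subseteq> D"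
      by (auto simp: line_def v0_def D_def cube_def axis_nth_if)
    moreover have "W e > a" if "e \<in> line v0 i0 1" for e
      using that out0 by (auto simp: line_def v0_def axis_zero)
    ultimately have "(f (v0 + axis i0 (int p)) - f (v0 + axis i0 (int q)))\<^sup>2 \<le> real 1 / a * E"
      if "p \<le> 1" "q \<le> 1" for p q
      unfolding E_def using a nonneg finD that by (intro line_energy_bound) auto
    note this[of "if \<sigma>0 then 0 else 1" "if \<sigma>0 then 1 else 0"]
    moreover have "v0 + axis i0 (int (if \<sigma>0 then 0 else 1)) = x" "v0 + axis i0 (int (if \<sigma>0 then 1 else 0)) = y"
      by (auto simp: vec_eq_iff v0_def y_nth axis_nth_if)
    ultimately show ?thesis by (simp only:) (simp split: if_splits)
  qed
  \<comment> \<open>Labels of rays: \<open>b\<close> selects the endpoint \<open>y\<close> or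
    \<open>x\<close>, \<open>\<sigma>\<close> the sign and \<open>k\<close> the direction. At
    \<open>y\<close> the ray back to \<open>x\<close> is left out, and at \<open>x\<close> both rays
    parallel to the open edge, so that parallel rays from different endpoints differ in coordinate
    \<open>i0\<close>. The remaining 4d - 3 labels still outnumber 2d closed edges, as d >=
    2.\<close>
  define L where "L = {(b, \<sigma>, k). if b then (\<sigma>, k) \<noteq> (\<not> \<sigma>0, i0) else k \<noteq> i0}"
  define base where "base b = (if b then y else x)" for b
  \<comment> \<open>A \<open>line\<close> only runs in the positive direction, so a negative ray is
    the line that begins \<open>2 * d\<close> steps before the endpoint.\<close>
  define start where "start = (\<lambda>(b, \<sigma>, k). base b + axis k (if \<sigma> then 0 else - int (2 * d)))"
  define ray where "ray = (\<lambda>l. line (start l) (snd (snd l)) (2 * d))"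
  have near: "start l + axis (snd (snd l)) (int q) \<in> cube (2 * d + 1) x" if "q \<le> 2 * d" for l q
    using that by (auto simp: start_def base_def cube_def y_nth axis_nth_if split: prod.split)
  have "\<exists>l\<in>L. \<forall>e\<in>ray l. \<not> W e \<le> a"
  proof (rule ex_free_of_closed[where D = D])
    have "L = {True} \<times> (UNIV - {(\<not> \<sigma>0, i0)}) \<union> {False} \<times> (UNIV \<times> (UNIV - {i0}))"
      by (auto simp: L_def)
    then have "card L = card ({True} \<times> (UNIV - {(\<not> \<sigma>0, i0)})) +
        card ({False} \<times> ((UNIV :: bool set) \<times> (UNIV - {i0})))"
      by (simp only:) (rule card_Un_disjoint, auto)
    also have "\<dots> = (2 * d - 1) + 2 * (d - 1)"
      by (simp add: card_cartesian_product card_Diff_singleton card_UNIV_bool d_def flip: UNIV_Times_UNIV)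
    finally show "card {e \<in> D. W e \<le> a} < card L" using few' d2 by simp
    show "ray l \<subseteq> D" if "l \<in> L" for l
    proof
      fix e assume "e \<in> ray l"
      then obtain q where "q < 2 * d" "fst e = start l + axis (snd (snd l)) (int q)"
        by (auto simp: ray_def line_def)
      then have "fst e \<in> cube (2 * d + 1) x" using near[of q l] by simp
      then show "e \<in> D" by (cases e) (auto simp: D_def cube_def intro: order_trans)
    qed
    have lab: "k' = k \<and> (\<forall>q. q \<noteq> k \<longrightarrow> u $ q = base b $ q) \<and> (\<sigma> \<longleftrightarrow> base b $ k \<le> u $ k)"
      if "(u, k') \<in> ray (b, \<sigma>, k)" for u k' b \<sigma> k
      using that by (auto simp: ray_def mem_line_iff start_def axis_nth_if split: if_splits)
    have same: "(b, \<sigma>, k) = (b', \<sigma>', k')" if L: "(b, \<sigma>, k) \<in> L" "(b', \<sigma>', k') \<in> L"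
        and e: "(u, q) \<in> ray (b, \<sigma>, k)" "(u, q) \<in> ray (b', \<sigma>', k')" for b \<sigma> k b' \<sigma>' k' u q
    proof -
      have kk: "k' = k" using lab[OF e(1)] lab[OF e(2)] by simp
      have "b = b'"
      proof (rule ccontr)
        assume "b \<noteq> b'"
        then have "k \<noteq> i0" using L kk by (cases b) (auto simp: L_def)
        then have "base b $ i0 = base b' $ i0" using lab[OF e(1)] lab[OF e(2)] kk by metis
        then show False using \<open>b \<noteq> b'\<close> by (cases b; cases b') (auto simp: base_def y_nth split: if_splits)
      qed
      moreover have "\<sigma> = \<sigma>'" using lab[OF e(1)] lab[OF e(2)] kk \<open>b = b'\<close> by auto
      ultimately show ?thesis using kk by simp
    qed
    show "disjoint_family_on ray L"
      unfolding disjoint_family_on_def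
    proof (intro ballI impI)
      fix l l' assume "l \<in> L" "l' \<in> L" "l \<noteq> l'"
      then show "ray l \<inter> ray l' = {}"
        using same by (cases l; cases l') (simp only: disjoint_iff, metis surj_pair)
    qed
  qed (use finD in auto)
  then obtain b \<sigma> k where l: "(b, \<sigma>, k) \<in> L" and clean: "\<And>e. e \<in> ray (b, \<sigma>, k) \<Longrightarrow> W e > a"
    by (auto simp: not_le)
  define s where "s = start (b, \<sigma>, k)"
  have raysub: "line s k (2 * d) \<subseteq> D"
  proof
    fix e assume "e \<in> line s k (2 * d)"
    then obtain q where "q < 2 * d" "fst e = s + axis k (int q)" by (auto simp: line_def)
    then have "fst e \<in> cube (2 * d + 1) x" using near[of q "(b, \<sigma>, k)"] by (simp add: s_def)
    then show "e \<in> D" by (cases e) (auto simp: D_def cube_def intro: order_trans)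
  qed
  have "base b = s + axis k (int (if \<sigma> then 0 else 2 * d))"
    by (auto simp: s_def start_def axis_def vec_eq_iff)
  then have ray_bound: "(f (base b) - f (s + axis k (int q)))\<^sup>2 \<le> real (2 * d) / a * E" if "q \<le> 2 * d" for q
    unfolding E_def using that clean a nonneg finD raysub
    by (simp only:) (rule line_energy_bound, auto simp: ray_def s_def)
  \<comment> \<open>A second pigeonhole: transversal lines leave the \<open>2 * d + 1\<close> points
    of the clean ray, and one of them is clean. Their direction must be \<open>i\<close> or
    \<open>j\<close>, since a row is entered through one of its two initial sides.\<close>
  define k' where "k' = (if k = i then j else i)"
  have k': "k' \<noteq> k" using ij by (auto simp: k'_def)
  have cross_sub: "line (s + axis k (int q)) k' m \<subseteq> D" if "q \<le> 2 * d" for q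
  proof
    fix e assume "e \<in> line (s + axis k (int q)) k' m"
    then obtain p where "p < m" and e: "fst e = s + axis k (int q) + axis k' (int p)" by (auto simp: line_def)
    have "s + axis k (int q) \<in> cube (2 * d + 1) x" using near[of q "(b, \<sigma>, k)"] that by (simp add: s_def)
    then have A: "\<bar>(s + axis k (int q)) $ r - x $ r\<bar> \<le> int (2 * d + 1)" for r unfolding cube_def by blast
    have B: "\<bar>axis k' (int p) $ r\<bar> \<le> int m" for r using \<open>p < m\<close> by (simp add: axis_nth_if)
    have "\<bar>fst e $ r - x $ r\<bar> \<le> int (m + 2 * d + 1)" for r
      using A[of r] B[of r] unfolding e by simp
    then show "e \<in> D" by (cases e) (auto simp: D_def cube_def)
  qed
  have "disjoint_family_on (\<lambda>q. line (s + axis k (int q)) k' m) {..2 * d}"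
    unfolding disjoint_family_on_def using k' by (intro ballI impI disjoint_lines[of k]) (auto simp: axis_nth_if)
  then have "\<exists>q\<in>{..2 * d}. \<forall>e\<in>line (s + axis k (int q)) k' m. \<not> W e \<le> a"
    using few' cross_sub finD by (intro ex_free_of_closed[where D = D]) auto
  then obtain q where q: "q \<le> 2 * d" and clean': "\<And>e. e \<in> line (s + axis k (int q)) k' m \<Longrightarrow> W e > a"
    by (auto simp: not_le)
  define z where "z = s + axis k (int q)"
  have zc: "z \<in> cube (2 * d + 1) x" using near[of q "(b, \<sigma>, k)"] q by (simp add: z_def s_def)
  define p where "p = (if k = i then h z else v z)"
  define z' where "z' = z + axis k' (int p)"
  have p: "p \<le> m" using v h by (simp add: p_def less_imp_le)
  have "(f (z + axis k' (int 0)) - f (z + axis k' (int p)))\<^sup>2 \<le> real m / a * E"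
    unfolding E_def using clean' cross_sub[OF q] a nonneg finD p by (intro line_energy_bound) (auto simp: z_def)
  then have zz': "(f z - f z')\<^sup>2 \<le> real m / a * E" by (simp add: z'_def axis_zero)
  have bz: "(f (base b) - f z)\<^sup>2 \<le> real (2 * d) / a * E" using ray_bound[OF q] by (simp add: z_def)
  have xb: "(f x - f (base b))\<^sup>2 \<le> real 1 / a * E" using xy a E0 by (auto simp: base_def)
  have le_m: "real N / a * E \<le> real m / a * E" if "N \<le> m" for N
    using that a E0 by (intro mult_right_mono divide_right_mono) auto
  have tri: "(A + B + C)\<^sup>2 \<le> 3 * (A\<^sup>2 + B\<^sup>2 + C\<^sup>2)" for A B C :: real
  proof -
    have "3 * (A\<^sup>2 + B\<^sup>2 + C\<^sup>2) - (A + B + C)\<^sup>2 = (A - B)\<^sup>2 + (B - C)\<^sup>2 + (A - C)\<^sup>2"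
      by (simp add: power2_eq_square algebra_simps)
    then show ?thesis by (smt (verit) zero_le_power2)
  qed
  have "(f x - f z')\<^sup>2 = ((f x - f (base b)) + (f (base b) - f z) + (f z - f z'))\<^sup>2" by simp
  also have "\<dots> \<le> 3 * ((f x - f (base b))\<^sup>2 + (f (base b) - f z)\<^sup>2 + (f z - f z')\<^sup>2)" by (rule tri)
  also have "\<dots> \<le> 9 * (real m / a * E)"
  proof -
    have "1 \<le> m" using md d2 by simp
    then have "(f x - f (base b))\<^sup>2 \<le> real m / a * E" "(f (base b) - f z)\<^sup>2 \<le> real m / a * E"
      using bz xb le_m le_m[OF md] by (blast intro: order_trans)+
    then show ?thesis using zz' by argo
  qed
  finally have "(f x - f z')\<^sup>2 \<le> 9 * real m / a * E" by simp
  moreover have "z' \<in> {z + axis i (int (v z)), z + axis j (int (h z))}"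
    by (auto simp: z'_def k'_def p_def)
  ultimately show ?thesis using zc unfolding E_def D_def d_def by blast
qed

text \<open>Each site pays for a local path, with resistance of order \<open>1 / a\<close>, and for
  the whole row that follows. For fixed \<open>k\<close> only boundedly many sites use a given edge
  in the \<open>k\<close>-th rectangle of their rows; the \<open>n + 1\<close> values of
  \<open>k\<close> give the factor next to \<open>R\<close>.\<close>

lemma spectral_bound:
  fixes f :: "int ^ 'n \<Rightarrow> real"
  assumes dim: "CARD('n) \<ge> 2" and ij: "i \<noteq> j" and nonneg: "\<And>e. W e \<ge> 0" and a: "a > 0"
    and m: "2 * CARD('n) \<le> m" and n: "2 * CARD('n) + 1 \<le> n"
    and supp: "\<And>x. x \<notin> cube n 0 \<Longrightarrow> f x = 0"
    and out: "\<And>x. x \<in> cube n 0 \<Longrightarrow> \<exists>e\<in>star x. W e > a"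
    and few: "\<And>x. x \<in> cube n 0 \<Longrightarrow>
      card {e \<in> cube (m + 2 * CARD('n) + 1) x \<times> UNIV. W e \<le> a} \<le> 2 * CARD('n)"
    and level: "\<And>z k. z \<in> cube (2 * n) 0 \<Longrightarrow> k \<le> n \<Longrightarrow>
      \<exists>s>0. card {e \<in> rect m i j (z + axis i (int (k * m))). W e \<le> s} < m \<and> 1 / s \<le> T (z + axis i (int (k * m)))"
    and row: "\<And>z. z \<in> cube (2 * n) 0 \<Longrightarrow> (\<Sum>k\<le>n. T (z + axis i (int (k * m)))) \<le> R"
  defines "\<kappa> \<equiv> (2 * (2 * m + 2 * CARD('n) + 1) + 1) ^ CARD('n)"
  shows "\<exists>S. finite S \<and> (\<Sum>x\<in>cube n 0. (f x)\<^sup>2) \<le>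
     (18 * real m * real \<kappa> / a + 36 * real m * real \<kappa> * R * (real n + 1)) * (\<Sum>e\<in>S. edge_energy W f e)"
proof -
  define d where "d = CARD('n)"
  define F where "F = edge_energy W f"
  have F0: "F e \<ge> 0" for e by (simp add: F_def edge_energy_def nonneg)
  have d2: "d \<ge> 2" and md: "2 * d \<le> m" and nd: "2 * d + 1 \<le> n" using dim m n by (auto simp: d_def)
  define Er where "Er z = (\<Sum>k\<le>n. \<Sum>e\<in>rect m i j (z + axis i (int (k * m))). F e)" for z
  have Er0: "Er z \<ge> 0" for z unfolding Er_def by (intro sum_nonneg F0)
  have "\<exists>v h. v < m \<and> h < m \<and> (z \<in> cube (2 * n) 0 \<longrightarrow>
      (f (z + axis i (int v)))\<^sup>2 \<le> 18 * real m * R * Er z \<and> (f (z + axis j (int h)))\<^sup>2 \<le> 18 * real m * R * Er z)" for z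
  proof (cases "z \<in> cube (2 * n) 0")
    case True
    have vanish: "f x = 0" if "x $ i \<ge> z $ i + int (n * m)" for x
    proof (rule supp)
      \<comment> \<open>As \<open>m\<close> is at least 4, a row of \<open>n\<close> steps of length
        \<open>m\<close> that starts at coordinate at least \<open>- 2 * n\<close> ends beyond the
        box.\<close>
      have "n * 4 \<le> n * m" using md d2 by (intro mult_left_mono) auto
      then have "4 * int n \<le> int (n * m)" by linarith
      moreover have "z $ i \<ge> - 2 * int n" using True by (auto simp: cube_def abs_le_iff dest: spec[of _ i])
      ultimately have "x $ i > int n" using that nd by linarith
      then show "x \<notin> cube n 0" by (auto simp: cube_def abs_le_iff not_le intro: exI[of _ i])
    qed
    obtain v h where vh: "v < m" "h < m"
      and b: "(f (z + axis i (int v)))\<^sup>2 \<le> 18 * real m * (\<Sum>k\<le>n. T (z + axis i (int (k * m)))) * Er z"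
        "(f (z + axis j (int h)))\<^sup>2 \<le> 18 * real m * (\<Sum>k\<le>n. T (z + axis i (int (k * m)))) * Er z"
      using row_bound[where f = f and n = n, OF ij nonneg level[OF True] vanish] unfolding Er_def F_def by blast
    have "18 * real m * (\<Sum>k\<le>n. T (z + axis i (int (k * m)))) * Er z \<le> 18 * real m * R * Er z"
      using row[OF True] Er0 by (intro mult_right_mono mult_left_mono) auto
    then show ?thesis using vh b by (meson order_trans)
  next
    case False
    then show ?thesis using md d2 by (intro exI[of _ 0]) auto
  qed
  then obtain v h where vm: "\<And>z. v z < m" and hm: "\<And>z. h z < m"
    and vh: "\<And>z. z \<in> cube (2 * n) 0 \<Longrightarrow> (f (z + axis i (int (v z))))\<^sup>2 \<le> 18 * real m * R * Er z"
     "\<And>z. z \<in> cube (2 * n) 0 \<Longrightarrow> (f (z + axis j (int (h z))))\<^sup>2 \<le> 18 * real m * R * Er z"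
    by metis
  define Q where "Q x = cube (m + 2 * d + 1) x \<times> (UNIV :: 'n set)" for x :: "int ^ 'n"
  have "\<exists>z. z \<in> cube (2 * d + 1) x \<and> (f x)\<^sup>2 \<le> 18 * real m / a * (\<Sum>e\<in>Q x. F e) + 36 * real m * R * Er z"
    if x: "x \<in> cube n 0" for x
  proof -
    have "\<exists>z\<in>cube (2 * d + 1) x. \<exists>z'\<in>{z + axis i (int (v z)), z + axis j (int (h z))}.
        (f x - f z')\<^sup>2 \<le> 9 * real m / a * (\<Sum>e\<in>Q x. F e)"
      unfolding d_def F_def Q_def by (rule site_bound[where f = f, OF dim ij nonneg a m out[OF x] few[OF x] vm hm])
    then obtain z z' where z: "z \<in> cube (2 * d + 1) x" and z': "z' \<in> {z + axis i (int (v z)), z + axis j (int (h z))}"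
      and b: "(f x - f z')\<^sup>2 \<le> 9 * real m / a * (\<Sum>e\<in>Q x. F e)"
      by (elim bexE)
    have "z \<in> cube (2 * n) 0"
      unfolding cube_def
    proof (rule CollectI, rule allI)
      fix k
      have "\<bar>z $ k - x $ k\<bar> \<le> int (2 * d + 1)" "\<bar>x $ k\<bar> \<le> int n" using z x by (auto simp: cube_def)
      then show "\<bar>z $ k - 0 $ k\<bar> \<le> int (2 * n)" using nd by simp
    qed
    then have "(f z')\<^sup>2 \<le> 18 * real m * R * Er z" using vh z' by auto
    moreover have "(f x)\<^sup>2 \<le> 2 * (f x - f z')\<^sup>2 + 2 * (f z')\<^sup>2"
    proof -
      have "2 * (f x - f z')\<^sup>2 + 2 * (f z')\<^sup>2 - (f x)\<^sup>2 = (f x - 2 * f z')\<^sup>2"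
        by (simp add: power2_eq_square algebra_simps)
      then show ?thesis by (smt (verit) zero_le_power2)
    qed
    moreover have "18 * real m / a * (\<Sum>e\<in>Q x. F e) = 2 * (9 * real m / a * (\<Sum>e\<in>Q x. F e))" by simp
    ultimately show ?thesis using z b by (intro exI[of _ z] conjI) argo+
  qed
  then obtain Z where Z: "\<And>x. x \<in> cube n 0 \<Longrightarrow> Z x \<in> cube (2 * d + 1) x"
    and b: "\<And>x. x \<in> cube n 0 \<Longrightarrow> (f x)\<^sup>2 \<le> 18 * real m / a * (\<Sum>e\<in>Q x. F e) + 36 * real m * R * Er (Z x)"
    by metis
  define rr where "rr k x = rect m i j (Z x + axis i (int (k * m)))" for k x
  define S where "S = (\<Union>x\<in>cube n 0. Q x) \<union> (\<Union>x\<in>cube n 0. \<Union>k\<le>n. rr k x)"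
  have finS: "finite S" by (auto simp: S_def card_cube Q_def rr_def)
  have finX: "finite (cube n (0 :: int ^ 'n))" by (rule card_cube)
  have \<kappa>: "card A \<le> \<kappa>" if "A \<subseteq> cube (2 * m + 2 * d + 1) (y :: int ^ 'n)" for A y
    using card_mono[OF card_cube(1) that] by (simp add: card_cube \<kappa>_def d_def)
  have R0: "R \<ge> 0"
  proof -
    have z: "(0 :: int ^ 'n) \<in> cube (2 * n) 0" by (simp add: cube_def)
    have "T (0 + axis i (int (k * m))) \<ge> 0" if "k \<le> n" for k
      using level[OF z that] by (smt (verit) divide_nonneg_nonneg)
    then have "(\<Sum>k\<le>n. T (0 + axis i (int (k * m)))) \<ge> 0" by (intro sum_nonneg) auto
    then show ?thesis using row[OF z] by linarith
  qed
  have 1: "(\<Sum>x\<in>cube n 0. \<Sum>e\<in>Q x. F e) \<le> real \<kappa> * (\<Sum>e\<in>S. F e)"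
  proof (rule double_count_le[OF finX finS _ F0])
    fix e :: "(int ^ 'n) \<times> 'n"
    show "card {x \<in> cube n 0. e \<in> Q x} \<le> \<kappa>"
    proof (rule \<kappa>[of _ "fst e"], safe)
      fix x assume "e \<in> Q x"
      then have "\<bar>fst e $ k - x $ k\<bar> \<le> int (m + 2 * d + 1)" for k by (auto simp: Q_def cube_def)
      then have "\<bar>x $ k - fst e $ k\<bar> \<le> int (m + 2 * d + 1)" for k
        by (simp add: abs_minus_commute)
      then have "\<bar>x $ k - fst e $ k\<bar> \<le> int (2 * m + 2 * d + 1)" for k
        by (rule order_trans) simp
      then show "x \<in> cube (2 * m + 2 * d + 1) (fst e)" by (simp add: cube_def)
    qed
  qed (auto simp: S_def)
  have 2: "(\<Sum>x\<in>cube n 0. \<Sum>e\<in>rr k x. F e) \<le> real \<kappa> * (\<Sum>e\<in>S. F e)" if "k \<le> n" for k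
  proof (rule double_count_le[OF finX finS _ F0])
    fix e :: "(int ^ 'n) \<times> 'n"
    show "card {x \<in> cube n 0. e \<in> rr k x} \<le> \<kappa>"
    \<comment> \<open>With \<open>k\<close> fixed, \<open>e\<close> determines the start
      \<open>Z x\<close> of the row up to the size of one rectangle, and \<open>Z x\<close> is close
      to \<open>x\<close>.\<close>
    proof (rule \<kappa>[of _ "fst e - axis i (int (k * m))"], safe)
      fix x assume x: "x \<in> cube n 0" "e \<in> rr k x"
      then obtain \<alpha> \<beta> where \<alpha>\<beta>: "\<alpha> < 2 * m" "\<beta> < m"
        and e: "fst e = Z x + axis i (int (k * m)) + axis i (int \<alpha>) + axis j (int \<beta>)"
        by (auto simp: rr_def rect_def)
      have "\<bar>x $ q - (fst e - axis i (int (k * m))) $ q\<bar> \<le> int (2 * m + 2 * d + 1)" for q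
      proof -
        have zq: "\<bar>Z x $ q - x $ q\<bar> \<le> int (2 * d + 1)" using Z[OF x(1)] by (simp add: cube_def)
        have "(fst e - axis i (int (k * m))) $ q = Z x $ q + (axis i (int \<alpha>) $ q + axis j (int \<beta>) $ q)"
          by (simp add: e)
        moreover have "0 \<le> axis i (int \<alpha>) $ q + axis j (int \<beta>) $ q"
          "axis i (int \<alpha>) $ q + axis j (int \<beta>) $ q \<le> int (2 * m)"
          using \<alpha>\<beta> ij by (auto simp: axis_nth_if)
        ultimately show ?thesis using zq by (simp only: of_nat_add)
      qed
      then show "x \<in> cube (2 * m + 2 * d + 1) (fst e - axis i (int (k * m)))" unfolding cube_def by blast
    qed
  qed (use that in \<open>auto simp: S_def\<close>)
  have "(\<Sum>x\<in>cube n 0. (f x)\<^sup>2) \<le> (\<Sum>x\<in>cube n 0. 18 * real m / a * (\<Sum>e\<in>Q x. F e) + 36 * real m * R * Er (Z x))"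
    by (intro sum_mono b)
  also have "\<dots> = 18 * real m / a * (\<Sum>x\<in>cube n 0. \<Sum>e\<in>Q x. F e) + 36 * real m * R * (\<Sum>k\<le>n. \<Sum>x\<in>cube n 0. \<Sum>e\<in>rr k x. F e)"
    by (simp add: sum.distrib sum_distrib_left Er_def rr_def sum.swap[of _ "{..n}"])
  also have "\<dots> \<le> 18 * real m / a * (real \<kappa> * (\<Sum>e\<in>S. F e)) + 36 * real m * R * (\<Sum>k\<le>n. real \<kappa> * (\<Sum>e\<in>S. F e))"
    using 1 2 a R0 by (intro add_mono mult_left_mono sum_mono) auto
  also have "\<dots> = (18 * real m * real \<kappa> / a + 36 * real m * real \<kappa> * R * (real n + 1)) * (\<Sum>e\<in>S. F e)"
    by (simp add: field_simps)
  finally show ?thesis using finS unfolding F_def by blast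
qed

section \<open>Independence and the density of traps\<close>

text \<open>If with positive probability no \<open>A k\<close> with \<open>k \<ge> N\<close>
  occurred, then \<open>1 - p \<le> exp (- p)\<close> would bound all partial sums by minus the
  logarithm of that probability. Independence enters as the product formula for complements, which
  is the form obtained for the rings.\<close>

lemma (in prob_space) borel_cantelli2:
  assumes A: "\<And>k::nat. A k \<in> events"
    and ind: "\<And>J. finite J \<Longrightarrow> prob {\<omega> \<in> space M. \<forall>k\<in>J. \<omega> \<notin> A k} = (\<Prod>k\<in>J. prob {\<omega> \<in> space M. \<omega> \<notin> A k})"
    and div: "\<not> summable (\<lambda>k. prob (A k))"
  shows "AE \<omega> in M. \<forall>N. \<exists>k\<ge>N. \<omega> \<in> A k"
proof -
  have [measurable]: "A k \<in> events" for k by (rule A)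
  have "AE \<omega> in M. \<exists>k\<ge>N. \<omega> \<in> A k" for N
  proof -
    define B where "B = {\<omega> \<in> space M. \<forall>k\<ge>N. \<omega> \<notin> A k}"
    have B: "B \<in> events" unfolding B_def by measurable
    have le: "prob B \<le> exp (- (\<Sum>k<m. prob (A (k + N))))" for m
    proof -
      have "prob B \<le> prob {\<omega> \<in> space M. \<forall>k\<in>{N..<m + N}. \<omega> \<notin> A k}"
        by (rule finite_measure_mono) (auto simp: B_def)
      also have "\<dots> = (\<Prod>k\<in>{N..<m + N}. prob {\<omega> \<in> space M. \<omega> \<notin> A k})" by (rule ind) simp
      also have "\<dots> = (\<Prod>k\<in>{N..<m + N}. 1 - prob (A k))"
      proof (intro prod.cong refl)
        fix k show "prob {\<omega> \<in> space M. \<omega> \<notin> A k} = 1 - prob (A k)"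
          using prob_compl[OF A[of k]] by (simp add: set_diff_eq)
      qed
      also have "\<dots> \<le> (\<Prod>k\<in>{N..<m + N}. exp (- prob (A k)))"
      proof (intro prod_mono conjI)
        fix k show "1 - prob (A k) \<le> exp (- prob (A k))" using exp_ge_add_one_self[of "- prob (A k)"] by simp
      qed simp
      also have "\<dots> = exp (- (\<Sum>k\<in>{N..<m + N}. prob (A k)))" by (simp add: exp_sum sum_negf[symmetric])
      also have "(\<Sum>k\<in>{N..<m + N}. prob (A k)) = (\<Sum>k<m. prob (A (k + N)))"
        using sum.shift_bounds_nat_ivl[of "\<lambda>k. prob (A k)" 0 N m] by (simp add: atLeast0LessThan)
      finally show ?thesis .
    qed
    have "prob B = 0"
    proof (rule ccontr)
      assume "prob B \<noteq> 0"
      then have pos: "prob B > 0" by (simp add: zero_less_measure_iff)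
      have "(\<Sum>k<m. prob (A (k + N))) \<le> - ln (prob B)" for m
      proof -
        have "ln (prob B) \<le> ln (exp (- (\<Sum>k<m. prob (A (k + N)))))"
          using le[of m] pos by (subst ln_le_cancel_iff) auto
        then show ?thesis by simp
      qed
      then have "summable (\<lambda>k. prob (A (k + N)))"
        by (intro summableI_nonneg_bounded[where x = "- ln (prob B)"]) auto
      then show False using div summable_iff_shift[of "\<lambda>k. prob (A k)" N] by simp
    qed
    then have "AE \<omega> in M. \<omega> \<notin> B" using B prob_eq_0 by blast
    then show ?thesis using AE_space by eventually_elim (auto simp: B_def)
  qed
  then show ?thesis by (simp add: AE_all_countable)
qed

section \<open>Edge stars and events determined by closed edges\<close>

lemma finite_star [simp]: "finite (star x)"
  by (simp add: star_def)

lemma card_star: "card (star (x :: int ^ 'n)) = 2 * CARD('n)"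
proof -
  have "card (star x) = card (UNIV :: (bool \<times> 'n) set)"
    unfolding star_def by (rule card_image) (auto simp: inj_on_def vec_eq_iff axis_nth_if split: if_splits)
  then show ?thesis by (simp add: card_cartesian_product card_UNIV_bool flip: UNIV_Times_UNIV)
qed

lemma star_overlap:
  assumes "star x \<inter> star y \<noteq> {}"
  shows "y \<in> cube 1 x"
proof -
  obtain e where e: "e \<in> star x" "e \<in> star y" using assms by blast
  have "\<exists>i. y = x \<or> y = x + axis i 1 \<or> x = y + axis i 1"
    using e by (auto simp: star_def split: if_splits) (metis diff_add_cancel)+
  then show ?thesis by (auto simp: cube_def axis_nth_if)
qed

text \<open>Nearly every event below is a predicate of a finite set of closed edges. The map to this
  set takes values in the finite \<open>Pow K\<close>, where all subsets are measurable, so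
  arbitrary predicates need no measurability argument of their own.\<close>

lemma measurable_closed_set:
  assumes "finite K"
  shows "(\<lambda>h. {e \<in> K. h e \<le> (s::real)}) \<in> measurable (PiM K (\<lambda>_. borel)) (count_space (Pow K))"
proof (subst measurable_count_space_eq2)
  show "finite (Pow K)" using assms by simp
  have "(\<lambda>h. {e \<in> K. h e \<le> s}) -` {A} \<inter> space (PiM K (\<lambda>_. borel)) =
      {h \<in> space (PiM K (\<lambda>_. borel)). \<forall>e\<in>K. h e \<le> s \<longleftrightarrow> e \<in> A}" if "A \<subseteq> K" for A
    using that by auto
  moreover have "{h \<in> space (PiM K (\<lambda>_. borel)). \<forall>e\<in>K. h e \<le> s \<longleftrightarrow> e \<in> A} \<in> sets (PiM K (\<lambda>_. borel))" for A
  proof (rule sets.sets_Collect_finite_All[OF _ assms])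
    fix e assume "e \<in> K"
    then have [measurable]: "(\<lambda>h. h e) \<in> borel_measurable (PiM K (\<lambda>_. borel))"
      by (rule measurable_component_singleton)
    show "{h \<in> space (PiM K (\<lambda>_. borel)). h e \<le> s \<longleftrightarrow> e \<in> A} \<in> sets (PiM K (\<lambda>_. borel))"
      by measurable
  qed
  ultimately show "(\<lambda>h. {e \<in> K. h e \<le> s}) \<in> space (PiM K (\<lambda>_. borel)) \<rightarrow> Pow K \<and>
     (\<forall>a\<in>Pow K. (\<lambda>h. {e \<in> K. h e \<le> s}) -` {a} \<inter> space (PiM K (\<lambda>_. borel)) \<in> sets (PiM K (\<lambda>_. borel)))"
    by auto
qed

locale iid_weights = prob_space M for M :: "'a measure" +
  fixes W :: "(int ^ 'n) \<times> 'n \<Rightarrow> 'a \<Rightarrow> real" and F :: "real \<Rightarrow> real"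
  assumes indep: "indep_vars (\<lambda>_. borel) W UNIV"
    and cdf: "\<And>e s. prob {\<omega> \<in> space M. W e \<omega> \<le> s} = F s"
begin

lemma W_measurable [measurable]: "W e \<in> borel_measurable M"
  using indep unfolding indep_vars_def by blast

lemma F_nonneg: "0 \<le> F s" and F_le_1: "F s \<le> 1"
  using cdf[of undefined s] by (metis measure_nonneg, metis prob_le_1)

lemma F_mono: "s \<le> t \<Longrightarrow> F s \<le> F t"
  unfolding cdf[of undefined, symmetric] by (rule finite_measure_mono) auto

text \<open>The level \<open>s l\<close> may change from block to block, as it does for the rings,
  each of which has its own scale.\<close>

lemma indep_closed_sets:
  assumes "finite L" "\<And>l. l \<in> L \<Longrightarrow> finite (K l)" "disjoint_family_on K L"
  shows "prob {\<omega> \<in> space M. \<forall>l\<in>L. P l {e \<in> K l. W e \<omega> \<le> s l}} =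
    (\<Prod>l\<in>L. prob {\<omega> \<in> space M. P l {e \<in> K l. W e \<omega> \<le> s l}})"
proof (cases "L = {}")
  case False
  have 1: "indep_vars (\<lambda>l. PiM (K l) (\<lambda>_. borel)) (\<lambda>l \<omega>. restrict (\<lambda>e. W e \<omega>) (K l)) L"
    using indep assms(3) by (intro indep_vars_restrict[where I = UNIV]) auto
  have 2: "indep_vars (\<lambda>l. count_space (Pow (K l))) (\<lambda>l \<omega>. {e \<in> K l. restrict (\<lambda>e. W e \<omega>) (K l) e \<le> s l}) L"
    by (rule indep_vars_compose2[OF 1]) (rule measurable_closed_set, rule assms(2))
  have 3: "(\<lambda>\<omega>. {e \<in> K l. restrict (\<lambda>e. W e \<omega>) (K l) e \<le> s l}) -` {A \<in> Pow (K l). P l A} \<inter> space M =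
      {\<omega> \<in> space M. P l {e \<in> K l. W e \<omega> \<le> s l}}" for l
    by (auto cong: conj_cong)
  have "prob (\<Inter>l\<in>L. {\<omega> \<in> space M. P l {e \<in> K l. W e \<omega> \<le> s l}}) =
    (\<Prod>l\<in>L. prob {\<omega> \<in> space M. P l {e \<in> K l. W e \<omega> \<le> s l}})"
    using indep_varsD[OF 2 False assms(1) subset_refl, of "\<lambda>l. {A \<in> Pow (K l). P l A}"] unfolding 3 by auto
  moreover have "(\<Inter>l\<in>L. {\<omega> \<in> space M. P l {e \<in> K l. W e \<omega> \<le> s l}}) =
      {\<omega> \<in> space M. \<forall>l\<in>L. P l {e \<in> K l. W e \<omega> \<le> s l}}" using False by auto
  ultimately show ?thesis by simp
qed (simp add: prob_space)

lemma closed_set_event: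
  assumes "finite K"
  shows "{\<omega> \<in> space M. P {e \<in> K. W e \<omega> \<le> s}} \<in> events"
proof -
  have "(\<lambda>\<omega>. restrict (\<lambda>e. W e \<omega>) K) \<in> measurable M (PiM K (\<lambda>_. borel))"
    by (intro measurable_restrict) simp
  from measurable_compose[OF this measurable_closed_set[OF assms]]
  have "(\<lambda>\<omega>. {e \<in> K. restrict (\<lambda>e. W e \<omega>) K e \<le> s}) \<in> measurable M (count_space (Pow K))" .
  then have "(\<lambda>\<omega>. {e \<in> K. restrict (\<lambda>e. W e \<omega>) K e \<le> s}) -` {A \<in> Pow K. P A} \<inter> space M \<in> events"
    by (rule measurable_sets) auto
  also have "(\<lambda>\<omega>. {e \<in> K. restrict (\<lambda>e. W e \<omega>) K e \<le> s}) -` {A \<in> Pow K. P A} \<inter> space M =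
      {\<omega> \<in> space M. P {e \<in> K. W e \<omega> \<le> s}}" by (auto cong: conj_cong)
  finally show ?thesis .
qed

lemma prob_all_closed:
  assumes "finite A"
  shows "prob {\<omega> \<in> space M. \<forall>e\<in>A. W e \<omega> \<le> s} = F s ^ card A"
proof (cases "A = {}")
  case False
  have "prob (\<Inter>e\<in>A. W e -` {..s} \<inter> space M) = (\<Prod>e\<in>A. prob (W e -` {..s} \<inter> space M))"
    by (rule indep_varsD[OF indep False assms]) auto
  moreover have "W e -` {..s} \<inter> space M = {\<omega> \<in> space M. W e \<omega> \<le> s}" for e by auto
  moreover have "(\<Inter>e\<in>A. {\<omega> \<in> space M. W e \<omega> \<le> s}) = {\<omega> \<in> space M. \<forall>e\<in>A. W e \<omega> \<le> s}" using False by auto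
  ultimately show ?thesis by (simp add: cdf)
qed (simp add: prob_space)

text \<open>Union bound over the \<open>k\<close>-element subsets. Their number is crudely replaced
  by that of all subsets, since \<open>D\<close> has bounded size in every use.\<close>

lemma prob_many_closed:
  assumes "finite D"
  shows "prob {\<omega> \<in> space M. k \<le> card {e \<in> D. W e \<omega> \<le> s}} \<le> 2 ^ card D * F s ^ k"
proof -
  define Z where "Z = {A. A \<subseteq> D \<and> card A = k}"
  have fZ: "finite Z" and cZ: "card Z \<le> 2 ^ card D"
    using assms card_mono[of "Pow D" Z] by (auto simp: Z_def card_Pow)
  have fin: "finite A" if "A \<in> Z" for A using that assms by (auto simp: Z_def intro: finite_subset)
  have meas: "{\<omega> \<in> space M. \<forall>e\<in>A. W e \<omega> \<le> s} \<in> events" if "A \<in> Z" for A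
    using fin[OF that] by measurable
  have "prob {\<omega> \<in> space M. k \<le> card {e \<in> D. W e \<omega> \<le> s}} \<le> prob (\<Union>A\<in>Z. {\<omega> \<in> space M. \<forall>e\<in>A. W e \<omega> \<le> s})"
  proof (rule finite_measure_mono)
    show "{\<omega> \<in> space M. k \<le> card {e \<in> D. W e \<omega> \<le> s}} \<subseteq> (\<Union>A\<in>Z. {\<omega> \<in> space M. \<forall>e\<in>A. W e \<omega> \<le> s})"
    proof safe
      fix \<omega> assume \<omega>: "\<omega> \<in> space M" "k \<le> card {e \<in> D. W e \<omega> \<le> s}"
      obtain A where "A \<subseteq> {e \<in> D. W e \<omega> \<le> s}" "card A = k"
        using obtain_subset_with_card_n[OF \<omega>(2)] by blast
      then show "\<omega> \<in> (\<Union>A\<in>Z. {\<omega> \<in> space M. \<forall>e\<in>A. W e \<omega> \<le> s})" using \<omega>(1) by (auto simp: Z_def)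
    qed
  qed (use fZ meas in auto)
  also have "\<dots> \<le> (\<Sum>A\<in>Z. prob {\<omega> \<in> space M. \<forall>e\<in>A. W e \<omega> \<le> s})"
    using fZ meas by (intro finite_measure_subadditive_finite) auto
  also have "\<dots> = (\<Sum>A\<in>Z. F s ^ k)"
    using fin by (intro sum.cong) (auto simp: prob_all_closed Z_def)
  also have "\<dots> \<le> 2 ^ card D * F s ^ k"
  proof -
    have "real (card Z) \<le> real (2 ^ card D)" using cZ by (simp only: of_nat_le_iff)
    then show ?thesis using F_nonneg[of s] by (simp add: mult_right_mono)
  qed
  finally show ?thesis .
qed

section \<open>Trap-free sets and the local lemma\<close>

definition escapes :: "real \<Rightarrow> (int ^ 'n) set \<Rightarrow> 'a set" where
  "escapes s S = {\<omega> \<in> space M. \<forall>x\<in>S. \<exists>e\<in>star x. W e \<omega> > s}"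

definition traps :: "real \<Rightarrow> int ^ 'n \<Rightarrow> 'a set" where
  "traps s x = {\<omega> \<in> space M. \<forall>e\<in>star x. W e \<omega> \<le> s}"

lemma escapes_as_closed_set:
  "escapes s S = {\<omega> \<in> space M. \<forall>x\<in>S. \<not> star x \<subseteq> {e \<in> \<Union> (star ` S). W e \<omega> \<le> s}}"
proof -
  have "(\<exists>e\<in>star x. W e \<omega> > s) \<longleftrightarrow> \<not> star x \<subseteq> {e \<in> \<Union> (star ` S). W e \<omega> \<le> s}" if "x \<in> S" for x \<omega>
    using that by (auto simp: subset_eq not_le)
  then show ?thesis unfolding escapes_def by blast
qed

lemma traps_as_closed_set: "traps s x = {\<omega> \<in> space M. star x \<subseteq> {e \<in> star x. W e \<omega> \<le> s}}"
  unfolding traps_def by auto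

lemma escapes_event [measurable]: "finite S \<Longrightarrow> escapes s S \<in> events"
  unfolding escapes_as_closed_set by (rule closed_set_event) simp

lemma traps_event [measurable]: "traps s x \<in> events"
  unfolding traps_as_closed_set by (rule closed_set_event) simp

lemma prob_traps: "prob (traps s x) = F s ^ (2 * CARD('n))"
  unfolding traps_def by (simp add: prob_all_closed card_star)

lemma prob_trap_escapes_indep:
  assumes "finite S" "\<And>y. y \<in> S \<Longrightarrow> star x \<inter> star y = {}"
  shows "prob (traps s x \<inter> escapes s S) = prob (traps s x) * prob (escapes s S)"
proof -
  define K where "K b = (if b then star x else \<Union> (star ` S))" for b
  define P where "P b A = (if b then star x \<subseteq> A else \<forall>y\<in>S. \<not> star y \<subseteq> A)" for b and A :: "((int ^ 'n) \<times> 'n) set"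
  have "prob {\<omega> \<in> space M. \<forall>b\<in>UNIV. P b {e \<in> K b. W e \<omega> \<le> s}} =
     (\<Prod>b\<in>UNIV. prob {\<omega> \<in> space M. P b {e \<in> K b. W e \<omega> \<le> s}})"
    using assms by (intro indep_closed_sets) (auto simp: K_def disjoint_family_on_def)
  moreover have "{\<omega> \<in> space M. P True {e \<in> K True. W e \<omega> \<le> s}} = traps s x"
    by (simp add: P_def K_def traps_as_closed_set)
  moreover have "{\<omega> \<in> space M. P False {e \<in> K False. W e \<omega> \<le> s}} = escapes s S"
    by (simp add: P_def K_def escapes_as_closed_set)
  moreover have "{\<omega> \<in> space M. \<forall>b\<in>UNIV. P b {e \<in> K b. W e \<omega> \<le> s}} = traps s x \<inter> escapes s S"
    by (auto simp: P_def K_def traps_as_closed_set escapes_as_closed_set UNIV_bool)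
  ultimately show ?thesis by (simp add: UNIV_bool)
qed

text \<open>The inductive step of the Lovasz local lemma.\<close>

lemma prob_trap_escapes_le:
  assumes small: "4 * 3 ^ CARD('n) * F s ^ (2 * CARD('n)) \<le> 1" and "finite S" "x \<notin> S"
  shows "prob (traps s x \<inter> escapes s S) \<le> 2 * F s ^ (2 * CARD('n)) * prob (escapes s S)"
  using assms(2,3)
proof (induction "card S" arbitrary: S x rule: less_induct)
  case less
  define q where "q = F s ^ (2 * CARD('n))"
  have q0: "q \<ge> 0" by (simp add: q_def F_nonneg)
  define N where "N = {y \<in> S. star x \<inter> star y \<noteq> {}}"
  have fS: "finite (S - N)" "finite N" using less.prems by (auto simp: N_def)
  have "card N \<le> card (cube 1 x)"
    by (rule card_mono[OF card_cube(1)], rule subsetI, rule star_overlap) (simp add: N_def)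
  then have cN: "card N \<le> 3 ^ CARD('n)" by (simp add: card_cube)
  have esc: "escapes s S \<subseteq> escapes s (S - N)" by (auto simp: escapes_def)
  have "prob (traps s x \<inter> escapes s S) \<le> prob (traps s x \<inter> escapes s (S - N))"
    using esc fS by (intro finite_measure_mono) auto
  also have "\<dots> = q * prob (escapes s (S - N))"
    unfolding q_def prob_traps[symmetric, of s x] using fS by (intro prob_trap_escapes_indep) (auto simp: N_def)
  finally have 1: "prob (traps s x \<inter> escapes s S) \<le> q * prob (escapes s (S - N))" .
  \<comment> \<open>Sites outside \<open>N\<close> were handled by independence. For the at most 3^d
    sites of \<open>N\<close>, the induction hypothesis for \<open>S - N\<close> gives a total
    conditional trap probability of at most \<open>3 ^ d * 2 * q\<close>, hence at most 1/2, so
    restoring \<open>N\<close> at most halves the probability.\<close>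
  have "prob (escapes s (S - N)) \<le> 2 * prob (escapes s S)"
  proof (cases "N = {}")
    case False
    then have less': "card (S - N) < card S" using less.prems by (intro psubset_card_mono) (auto simp: N_def)
    have "prob (escapes s (S - N)) \<le> prob (escapes s S \<union> (\<Union>y\<in>N. traps s y \<inter> escapes s (S - N)))"
    proof (rule finite_measure_mono)
      show "escapes s (S - N) \<subseteq> escapes s S \<union> (\<Union>y\<in>N. traps s y \<inter> escapes s (S - N))"
        unfolding escapes_def traps_def by (auto simp flip: not_le)
    qed (use fS less.prems in auto)
    also have "\<dots> \<le> prob (escapes s S) + prob (\<Union>y\<in>N. traps s y \<inter> escapes s (S - N))"
      using fS less.prems by (intro measure_Un_le) auto
    also have "prob (\<Union>y\<in>N. traps s y \<inter> escapes s (S - N)) \<le> (\<Sum>y\<in>N. prob (traps s y \<inter> escapes s (S - N)))"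
      using fS by (intro finite_measure_subadditive_finite) auto
    also have "\<dots> \<le> (\<Sum>y\<in>N. 2 * q * prob (escapes s (S - N)))"
      unfolding q_def using less' fS by (intro sum_mono less.hyps) (auto simp: N_def)
    also have "\<dots> = real (card N) * (2 * q * prob (escapes s (S - N)))" by simp
    also have "\<dots> \<le> 3 ^ CARD('n) * (2 * q * prob (escapes s (S - N)))"
      using cN q0 by (intro mult_right_mono) (auto simp flip: of_nat_le_iff)
    also have "\<dots> = (4 * 3 ^ CARD('n) * q) * (prob (escapes s (S - N)) / 2)" by simp
    also have "\<dots> \<le> 1 * (prob (escapes s (S - N)) / 2)"
      using small by (intro mult_right_mono) (auto simp: q_def)
    finally show ?thesis by simp
  qed simp
  then have "q * prob (escapes s (S - N)) \<le> q * (2 * prob (escapes s S))"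
    using q0 by (rule mult_left_mono)
  with 1 show ?case by (simp add: q_def)
qed

text \<open>Sites are added one at a time; by the conditional bound each keeps at least the fraction
  1 - 2q of the probability, where q is the probability of a trap.\<close>

lemma prob_escapes_ge:
  assumes small: "4 * 3 ^ CARD('n) * F s ^ (2 * CARD('n)) \<le> 1" and "finite S"
  shows "prob (escapes s S) \<ge> (1 - 2 * F s ^ (2 * CARD('n))) ^ card S"
  using assms(2)
proof (induction S rule: finite_induct)
  case empty
  then show ?case by (simp add: escapes_def prob_space)
next
  case (insert x S)
  define q where "q = F s ^ (2 * CARD('n))"
  have "1 \<le> (3::real) ^ CARD('n)" by simp
  moreover have "q \<ge> 0" by (simp add: q_def F_nonneg)
  ultimately have "4 * q \<le> 4 * 3 ^ CARD('n) * q" by (intro mult_right_mono) auto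
  then have q1: "1 - 2 * q \<ge> 0" using small by (simp add: q_def)
  have "prob (escapes s S) \<le> prob (escapes s (insert x S) \<union> (traps s x \<inter> escapes s S))"
    using insert by (intro finite_measure_mono) (auto simp: escapes_def traps_def not_le)
  also have "\<dots> \<le> prob (escapes s (insert x S)) + prob (traps s x \<inter> escapes s S)"
    using insert by (intro measure_Un_le) auto
  also have "prob (traps s x \<inter> escapes s S) \<le> 2 * q * prob (escapes s S)"
    unfolding q_def by (rule prob_trap_escapes_le[OF small insert(1,2)])
  finally have "(1 - 2 * q) * prob (escapes s S) \<le> prob (escapes s (insert x S))" by (simp add: algebra_simps)
  moreover have "(1 - 2 * q) * (1 - 2 * q) ^ card S \<le> (1 - 2 * q) * prob (escapes s S)"
    using insert.IH q1 by (intro mult_left_mono) (auto simp: q_def)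
  ultimately show ?case using insert by (simp add: q_def)
qed

end

section \<open>Resistances of rows of rectangles\<close>

text \<open>An upper bound for the reciprocal of the highest level \<open>s l\<close>, \<open>j \<le> l \<le> J\<close>, at which fewer
  than \<open>m\<close> edges of \<open>K\<close> are closed, written as a sum of indicators.\<close>

definition resist :: "(nat \<Rightarrow> real) \<Rightarrow> nat \<Rightarrow> nat \<Rightarrow> nat \<Rightarrow> 'e set \<Rightarrow> ('e \<Rightarrow> real) \<Rightarrow> real" where
  "resist s j J m K h = 1 / s j + (\<Sum>l\<in>{j..<J}. if m \<le> card {e \<in> K. h e \<le> s l} then 1 / s (Suc l) else 0)"

text \<open>At the first good index \<open>l\<close> beyond \<open>j\<close> the preceding index is
  bad, and its indicator carries precisely the summand \<open>1 / s l\<close>. The hypothesis at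
  \<open>J\<close> ensures that a good index exists before the sum is cut off.\<close>

lemma resist_level:
  assumes s: "\<And>l. s l > 0" and "j \<le> J" and "card {e \<in> K. h e \<le> s J} < m"
  shows "\<exists>t>0. card {e \<in> K. h e \<le> t} < m \<and> 1 / t \<le> resist s j J m K h"
proof -
  define l where "l = (LEAST l. j \<le> l \<and> card {e \<in> K. h e \<le> s l} < m)"
  have l: "j \<le> l \<and> card {e \<in> K. h e \<le> s l} < m"
    unfolding l_def by (rule LeastI[of _ J]) (use assms in auto)
  have lJ: "l \<le> J" unfolding l_def by (rule Least_le) (use assms in auto)
  have nonneg: "(if m \<le> card {e \<in> K. h e \<le> s l} then 1 / s (Suc l) else 0) \<ge> 0" for l
    using s[of "Suc l"] by simp
  have "1 / s l \<le> resist s j J m K h"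
  proof (cases "l = j")
    case True
    then show ?thesis unfolding resist_def using nonneg by (simp add: sum_nonneg)
  next
    case False
    then obtain l' where l': "l = Suc l'" "j \<le> l'" using l by (cases l) auto
    have "\<not> (j \<le> l' \<and> card {e \<in> K. h e \<le> s l'} < m)"
      using not_less_Least[of l' "\<lambda>l. j \<le> l \<and> card {e \<in> K. h e \<le> s l} < m"] l' unfolding l_def by simp
    then have "1 / s l = (if m \<le> card {e \<in> K. h e \<le> s l'} then 1 / s (Suc l') else 0)" using l' by simp
    also have "\<dots> \<le> (\<Sum>l\<in>{j..<J}. if m \<le> card {e \<in> K. h e \<le> s l} then 1 / s (Suc l) else 0)"
      by (rule member_le_sum) (use l' lJ s in \<open>auto simp: less_imp_le\<close>)
    also have "\<dots> \<le> resist s j J m K h" unfolding resist_def using s[of j] by simp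
    finally show ?thesis .
  qed
  then show ?thesis using l s by blast
qed

lemma resist_nonneg: "(\<And>l. s l > 0) \<Longrightarrow> 0 \<le> resist s j J m K h"
  unfolding resist_def by (intro add_nonneg_nonneg sum_nonneg) (auto simp: less_imp_le)

lemma resist_le: "(\<And>l. s l > 0) \<Longrightarrow> resist s j J m K h \<le> 1 / s j + (\<Sum>l\<in>{j..<J}. 1 / s (Suc l))"
  unfolding resist_def by (intro add_mono sum_mono) (auto simp: less_imp_le)

lemma resist_measurable:
  assumes "finite K"
  shows "resist s j J m K \<in> borel_measurable (PiM K (\<lambda>_. borel))"
proof -
  have "(\<lambda>h. if m \<le> card {e \<in> K. h e \<le> t} then a else 0 :: real) \<in> borel_measurable (PiM K (\<lambda>_. borel))" for t a :: real
    by (rule measurable_compose[OF measurable_closed_set[OF assms, of t],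
          where g = "\<lambda>A. if m \<le> card A then a else 0"]) simp
  then show ?thesis unfolding resist_def[abs_def] by (intro borel_measurable_add borel_measurable_sum) auto
qed

lemma resist_restrict: "resist s j J m K (restrict h K) = resist s j J m K h"
proof -
  have "{e \<in> K. restrict h K e \<le> t} = {e \<in> K. h e \<le> t}" for t by auto
  then show ?thesis unfolding resist_def by simp
qed

text \<open>Rectangles have length \<open>2 * m\<close> and spacing \<open>m\<close>, so only
  neighbours in a row can overlap.\<close>

lemma disjoint_rects:
  assumes "i \<noteq> j" "\<And>k k'. k \<in> I \<Longrightarrow> k' \<in> I \<Longrightarrow> k < k' \<Longrightarrow> k + 2 \<le> k'"
  shows "disjoint_family_on (\<lambda>k. rect m i j (z + axis i (int (k * m)))) I"
proof -
  have *: "rect m i j (z + axis i (int (k * m))) \<inter> rect m i j (z + axis i (int (k' * m))) = {}"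
    if "k + 2 \<le> k'" for k k'
  proof (rule equals0I)
    fix e assume e: "e \<in> rect m i j (z + axis i (int (k * m))) \<inter> rect m i j (z + axis i (int (k' * m)))"
    have coord: "c $ i \<le> fst e $ i \<and> fst e $ i < c $ i + int (2 * m)" if "e \<in> rect m i j c" for c
      using that assms(1) by (auto simp: rect_def axis_nth_if)
    have "fst e $ i < z $ i + int (k * m) + int (2 * m)" "fst e $ i \<ge> z $ i + int (k' * m)"
      using coord[of "z + axis i (int (k * m))"] coord[of "z + axis i (int (k' * m))"] e
      by (simp_all add: axis_nth_if)
    moreover have "(k + 2) * m \<le> k' * m" using that by (rule mult_right_mono) simp
    then have "int (k * m) + int (2 * m) \<le> int (k' * m)"
      by (simp only: of_nat_add[symmetric] of_nat_le_iff) (simp add: algebra_simps)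
    ultimately show False by linarith
  qed
  show ?thesis unfolding disjoint_family_on_def
  proof (intro ballI impI)
    fix k k' assume "k \<in> I" "k' \<in> I" "k \<noteq> k'"
    then show "rect m i j (z + axis i (int (k * m))) \<inter> rect m i j (z + axis i (int (k' * m))) = {}"
      using *[of k k'] *[of k' k] assms(2) by (metis Int_commute linorder_neqE_nat)
  qed
qed

context iid_weights begin

lemma resist_indep:
  assumes "disjoint_family_on K I" "\<And>k. k \<in> I \<Longrightarrow> finite (K k)"
  shows "indep_vars (\<lambda>_. borel) (\<lambda>k \<omega>. resist s j J m (K k) (\<lambda>e. W e \<omega>)) I"
proof -
  have 1: "indep_vars (\<lambda>l. PiM (K l) (\<lambda>_. borel)) (\<lambda>l \<omega>. restrict (\<lambda>e. W e \<omega>) (K l)) I"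
    using indep assms(1) by (intro indep_vars_restrict[where I = UNIV]) auto
  show ?thesis
    using indep_vars_compose2[OF 1, of "\<lambda>k. resist s j J m (K k)" "\<lambda>_. borel"] assms(2)
    by (simp add: resist_measurable resist_restrict)
qed

lemma resist_expectation_le:
  assumes s: "\<And>l. s l > 0" and K: "finite K" "card K \<le> N"
  shows "expectation (\<lambda>\<omega>. resist s j J m K (\<lambda>e. W e \<omega>)) \<le>
    1 / s j + (\<Sum>l\<in>{j..<J}. 2 ^ N * F (s l) ^ m / s (Suc l))"
proof -
  define A where "A l = {\<omega> \<in> space M. m \<le> card {e \<in> K. W e \<omega> \<le> s l}}" for l
  have A[measurable]: "A l \<in> events" for l unfolding A_def by (rule closed_set_event[OF K(1)])
  have "expectation (\<lambda>\<omega>. resist s j J m K (\<lambda>e. W e \<omega>)) =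
      expectation (\<lambda>\<omega>. 1 / s j + (\<Sum>l\<in>{j..<J}. 1 / s (Suc l) * indicator (A l) \<omega>))"
    by (rule Bochner_Integration.integral_cong) (auto simp: resist_def A_def indicator_def intro!: sum.cong)
  also have "\<dots> = 1 / s j + (\<Sum>l\<in>{j..<J}. 1 / s (Suc l) * prob (A l))"
  proof -
    define Y where "Y l \<omega> = 1 / s (Suc l) * indicator (A l) \<omega>" for l \<omega>
    have int: "integrable M (Y l)" for l
      unfolding Y_def using A[of l] by (intro integrable_mult_right integrable_real_indicator) (auto simp: emeasure_eq_measure)
    have EY: "expectation (Y l) = 1 / s (Suc l) * prob (A l)" for l
      unfolding Y_def using A[of l] sets.sets_into_space[OF A[of l]] by (subst integral_mult_right_zero) (simp add: Int_absorb2)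
    show ?thesis
      unfolding Y_def[symmetric] EY[symmetric] using int
      by (subst Bochner_Integration.integral_add) (auto simp: prob_space)
  qed
  also have "\<dots> \<le> 1 / s j + (\<Sum>l\<in>{j..<J}. 2 ^ N * F (s l) ^ m / s (Suc l))"
  proof (intro add_mono order_refl sum_mono)
    fix l
    have "prob (A l) \<le> 2 ^ card K * F (s l) ^ m" unfolding A_def by (rule prob_many_closed[OF K(1)])
    also have "\<dots> \<le> 2 ^ N * F (s l) ^ m"
      using K F_nonneg by (intro mult_right_mono power_increasing) auto
    finally show "1 / s (Suc l) * prob (A l) \<le> 2 ^ N * F (s l) ^ m / s (Suc l)"
      using s[of "Suc l"] by (simp add: divide_right_mono)
  qed
  finally show ?thesis .
qed

text \<open>Neighbouring rectangles share edges, so Hoeffding's inequality is applied to even and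
  odd \<open>k\<close> separately. If the whole row reaches the threshold, one of the two halves
  exceeds its mean by at least \<open>\<epsilon> * real n\<close>.\<close>

lemma prob_row_resist:
  assumes s: "\<And>l. s l > 0" and ij: "i \<noteq> i'" and n: "n \<ge> 1" and \<epsilon>: "\<epsilon> > 0"
    and B: "B = 1 / s j + (\<Sum>l\<in>{j..<J}. 1 / s (Suc l))"
    and \<mu>: "\<mu> = 1 / s j + (\<Sum>l\<in>{j..<J}. 2 ^ (4 * m\<^sup>2) * F (s l) ^ m / s (Suc l))"
  shows "prob {\<omega> \<in> space M. (\<Sum>k\<le>n. resist s j J m (rect m i i' (z + axis i (int (k * m)))) (\<lambda>e. W e \<omega>)) \<ge>
      (real n + 1) * \<mu> + 2 * \<epsilon> * real n} \<le> 2 * exp (- \<epsilon>\<^sup>2 * real n / B\<^sup>2)"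
proof -
  define K where "K k = rect m i i' (z + axis i (int (k * m)))" for k
  define X where "X k \<omega> = resist s j J m (K k) (\<lambda>e. W e \<omega>)" for k \<omega>
  define I where "I b = {k. k \<le> n \<and> even k = b}" for b
  have Bpos: "B > 0" unfolding B using s by (intro add_pos_nonneg sum_nonneg) (auto simp: less_imp_le)
  have finI: "finite (I b)" for b by (auto simp: I_def)
  have ne: "I b \<noteq> {}" for b using n by (cases b) (auto simp: I_def)
  have union: "I True \<union> I False = {..n}" "I True \<inter> I False = {}" by (auto simp: I_def)
  have "card (I b) \<le> card {..n}" for b by (rule card_mono) (auto simp: I_def)
  \<comment> \<open>A half has at most \<open>n + 1\<close>, hence at most \<open>2 * n\<close>
    terms; this 2 cancels the one in Hoeffding's exponent.\<close>
  then have cI: "real (card (I b)) \<le> 2 * real n" for b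
    using n by (smt (verit) card_atMost of_nat_Suc of_nat_le_iff of_nat_1)
  have X_nonneg: "0 \<le> X k \<omega>" and X_le: "X k \<omega> \<le> B" for k \<omega>
    using s by (auto simp: X_def B resist_nonneg resist_le)
  have indX: "indep_vars (\<lambda>_. borel) X (I b)" for b
    unfolding X_def
  proof (rule resist_indep)
    have "k + 2 \<le> k'" if "k \<in> I b" "k' \<in> I b" "k < k'" for k k'
      using that by (cases "k' = k + 1") (auto simp: I_def)
    then show "disjoint_family_on K (I b)" unfolding K_def by (intro disjoint_rects[OF ij])
  qed (simp add: K_def)
  have X_meas: "X k \<in> borel_measurable M" for k
  proof -
    have "disjoint_family_on K {k}" by (simp add: disjoint_family_on_def)
    then have "indep_vars (\<lambda>_. borel) X {k}" unfolding X_def by (rule resist_indep) (simp add: K_def)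
    then show ?thesis unfolding indep_vars_def by blast
  qed
  have EX: "expectation (X k) \<le> \<mu>" for k
    unfolding X_def \<mu> by (rule resist_expectation_le[OF s]) (auto simp: K_def card_rect_le)
  have half: "prob {\<omega> \<in> space M. (\<Sum>k\<in>I b. X k \<omega>) \<ge> (\<Sum>k\<in>I b. expectation (X k)) + \<epsilon> * real n}
      \<le> exp (- \<epsilon>\<^sup>2 * real n / B\<^sup>2)" for b
  proof -
    interpret Hoeffding_ineq M "I b" X "\<lambda>_. 0" "\<lambda>_. B" "\<Sum>k\<in>I b. expectation (X k)"
      by unfold_locales (use finI indX X_nonneg X_le in auto)
    have c0: "real (card (I b)) > 0" using ne finI by (simp add: card_gt_0_iff)
    have "prob {\<omega> \<in> space M. (\<Sum>k\<in>I b. X k \<omega>) \<ge> (\<Sum>k\<in>I b. expectation (X k)) + \<epsilon> * real n}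
        \<le> exp (- 2 * (\<epsilon> * real n)\<^sup>2 / (\<Sum>k\<in>I b. (B - 0)\<^sup>2))"
      by (rule Hoeffding_ineq_ge) (use \<epsilon> Bpos c0 in auto)
    also have "\<dots> = exp (- (2 * (\<epsilon> * real n)\<^sup>2 / (real (card (I b)) * B\<^sup>2)))" by simp
    also have "\<dots> \<le> exp (- (2 * (\<epsilon> * real n)\<^sup>2 / (2 * real n * B\<^sup>2)))"
      using cI c0 Bpos n by (simp only: exp_le_cancel_iff neg_le_iff_le)
        (intro divide_left_mono mult_right_mono mult_pos_pos; simp)
    also have "2 * (\<epsilon> * real n)\<^sup>2 / (2 * real n * B\<^sup>2) = \<epsilon>\<^sup>2 * real n / B\<^sup>2"
      using n Bpos by (simp add: field_simps power2_eq_square)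
    finally show ?thesis by simp
  qed
  define G where "G b = {\<omega> \<in> space M. (\<Sum>k\<in>I b. X k \<omega>) \<ge> (\<Sum>k\<in>I b. expectation (X k)) + \<epsilon> * real n}" for b
  have G: "G b \<in> events" for b unfolding G_def using X_meas by measurable
  have "prob {\<omega> \<in> space M. (\<Sum>k\<le>n. X k \<omega>) \<ge> (real n + 1) * \<mu> + 2 * \<epsilon> * real n} \<le> prob (G True \<union> G False)"
  proof (rule finite_measure_mono)
    show "{\<omega> \<in> space M. (\<Sum>k\<le>n. X k \<omega>) \<ge> (real n + 1) * \<mu> + 2 * \<epsilon> * real n} \<subseteq> G True \<union> G False"
    proof (rule subsetI, rule ccontr)
      fix \<omega> assume \<omega>: "\<omega> \<in> {\<omega> \<in> space M. (\<Sum>k\<le>n. X k \<omega>) \<ge> (real n + 1) * \<mu> + 2 * \<epsilon> * real n}" "\<omega> \<notin> G True \<union> G False"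
      have split: "(\<Sum>k\<le>n. Y k) = (\<Sum>k\<in>I True. Y k) + (\<Sum>k\<in>I False. Y k)" for Y :: "nat \<Rightarrow> real"
        unfolding union(1)[symmetric] by (rule sum.union_disjoint) (use finI union in auto)
      have "(\<Sum>k\<le>n. X k \<omega>) < (\<Sum>k\<le>n. expectation (X k)) + 2 * (\<epsilon> * real n)"
        using \<omega> unfolding split[of "\<lambda>k. X k \<omega>"] split[of "\<lambda>k. expectation (X k)"] G_def by auto
      moreover have "(\<Sum>k\<le>n. expectation (X k)) \<le> (real n + 1) * \<mu>"
        using sum_bounded_above[of "{..n}" "\<lambda>k. expectation (X k)" \<mu>] EX by (simp add: add.commute)
      ultimately show False using \<omega>(1) by auto
    qed
  qed (use G in auto)
  also have "\<dots> \<le> prob (G True) + prob (G False)" using G by (intro measure_Un_le) auto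
  also have "\<dots> \<le> 2 * exp (- \<epsilon>\<^sup>2 * real n / B\<^sup>2)" using half[of True] half[of False] unfolding G_def by simp
  finally show ?thesis unfolding X_def K_def .
qed

end

section \<open>Bad environments at dyadic scales\<close>

lemma (in prob_space) prob_Bex_le:
  assumes "finite X" "\<And>x. x \<in> X \<Longrightarrow> {\<omega> \<in> space M. P x \<omega>} \<in> events"
    and "\<And>x. x \<in> X \<Longrightarrow> prob {\<omega> \<in> space M. P x \<omega>} \<le> b"
  shows "prob {\<omega> \<in> space M. \<exists>x\<in>X. P x \<omega>} \<le> real (card X) * b"
proof -
  have "{\<omega> \<in> space M. \<exists>x\<in>X. P x \<omega>} = (\<Union>x\<in>X. {\<omega> \<in> space M. P x \<omega>})" by auto
  then have "prob {\<omega> \<in> space M. \<exists>x\<in>X. P x \<omega>} \<le> (\<Sum>x\<in>X. prob {\<omega> \<in> space M. P x \<omega>})"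
    using assms(1,2) by (simp only:) (intro finite_measure_subadditive_finite, auto)
  also have "\<dots> \<le> real (card X) * b" using assms(3) by (rule sum_bounded_above)
  finally show ?thesis .
qed

lemma card_cube_le: "real (card (cube (c * 2 ^ N) (0 :: int ^ 'n))) \<le> ((2 * real c + 1) * 2 ^ N) ^ CARD('n)"
proof -
  have "2 * (real c * 2 ^ N) + 1 \<le> (2 * real c + 1) * 2 ^ N"
    using one_le_power[of "2::real" N] by (simp add: algebra_simps)
  then show ?thesis by (simp add: card_cube power_mono add.commute)
qed

text \<open>Turns the Hoeffding exponential into an inverse power with an explicit constant.\<close>

lemma power_le_exp:
  fixes y :: real
  assumes "y \<ge> 0" "p > 0"
  shows "(y / real p) ^ p \<le> exp y"
proof -
  have "y / real p \<le> exp (y / real p)" using exp_ge_add_one_self[of "y / real p"] by linarith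
  then have "(y / real p) ^ p \<le> exp (y / real p) ^ p" using assms by (intro power_mono) auto
  also have "\<dots> = exp y" using assms by (simp flip: exp_of_nat_mult)
  finally show ?thesis .
qed

text \<open>Here \<open>G l\<close> stands for \<open>g (2 ^ l)\<close>, as only dyadic scales
  matter from now on. In \<open>trap_density\<close>, \<open>ln (real l)\<close> replaces the
  iterated logarithm of \<open>2 ^ l\<close>, from which it differs by an additive constant.\<close>

locale dyadic_weights = iid_weights M W F
  for M :: "'a measure" and W :: "(int ^ 'n) \<times> 'n \<Rightarrow> 'a \<Rightarrow> real" and F +
  fixes G :: "nat \<Rightarrow> real" and L :: nat and i i' :: 'n
  assumes dim: "CARD('n) \<ge> 2" and axes: "i \<noteq> i'"
    and W_pos: "\<And>e \<omega>. \<omega> \<in> space M \<Longrightarrow> W e \<omega> > 0"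
    and G_pos: "\<And>l. G l > 0"
    and G_decay: "\<And>l. L \<le> l \<Longrightarrow> 4 * G (Suc l) \<le> G l"
    and G_lim: "(\<lambda>l. 4 ^ l * G l) \<longlonglongrightarrow> 0"
    and trap_density: "\<And>\<epsilon>. \<epsilon> > 0 \<Longrightarrow>
      eventually (\<lambda>l. (2 ^ l) ^ CARD('n) * F (G l) ^ (2 * CARD('n)) \<le> \<epsilon> * ln (real l)) sequentially"
begin

section \<open>Consequences of decay and trap density\<close>

lemma G_ratio: "L \<le> l \<Longrightarrow> 4 ^ t * G (l + t) \<le> G l"
proof (induction t)
  case (Suc t)
  have "4 ^ Suc t * G (l + Suc t) = 4 ^ t * (4 * G (Suc (l + t)))" by simp
  also have "\<dots> \<le> 4 ^ t * G (l + t)" using Suc by (intro mult_left_mono G_decay) auto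
  also have "\<dots> \<le> G l" using Suc by simp
  finally show ?case .
qed simp

text \<open>Resistances are measured in the unit \<open>1 / (4 ^ N * G N)\<close>, which is 1/(n^2
  g(n)) at n = 2^N. In this unit level \<open>l\<close> costs at most \<open>4 ^ l\<close>,
  independently of \<open>N\<close>.\<close>

lemma G_ratio': "L \<le> l \<Longrightarrow> l \<le> N \<Longrightarrow> 4 ^ N * G N / G l \<le> 4 ^ l"
  using G_ratio[of l "N - l"] G_pos[of l] by (simp add: field_simps power_diff)

text \<open>Raising the threshold by the factor \<open>4 ^ q\<close> is no worse than going back
  \<open>q\<close> scales; this absorbs the large constant in the definition of closed
  edges.\<close>

lemma F_level: "q \<le> N \<Longrightarrow> L \<le> N - q \<Longrightarrow> F (4 ^ q * G N) \<le> F (G (N - q))"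
  using G_ratio[of "N - q" q] by (intro F_mono) simp

text \<open>Put X = 2^l F(G l)^2. The trap density bounds X^d, and hence X, by l, so F(G l)^4 = X^2
  / 4^l is at most l^2 / 4^l. Giving up half of the exponential rate swallows the factor
  l^2.\<close>

lemma F_G_decay: "eventually (\<lambda>l. F (G l) ^ 4 \<le> (1 / 2) ^ l) sequentially"
proof -
  have "eventually (\<lambda>l::nat. (real l)\<^sup>2 \<le> 2 ^ l) sequentially" by real_asymp
  then show ?thesis using trap_density[OF zero_less_one] eventually_ge_at_top[of 1]
  proof eventually_elim
    case (elim l)
    define X where "X = 2 ^ l * (F (G l))\<^sup>2"
    have X0: "X \<ge> 0" by (simp add: X_def)
    have "X ^ CARD('n) \<le> ln (real l)"
      using elim(2) by (simp add: X_def power_mult_distrib power_mult[symmetric] mult.commute)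
    also have "\<dots> \<le> real l" using elim(3) ln_le_minus_one[of "real l"] by simp
    finally have Xd: "X ^ CARD('n) \<le> real l" .
    have "X \<le> real l"
    proof (rule ccontr)
      assume "\<not> X \<le> real l"
      then have "X > real l" "X \<ge> 1" using elim(3) by auto
      then have "X ^ 1 \<le> X ^ CARD('n)" using dim by (intro power_increasing) auto
      then show False using Xd \<open>X > real l\<close> by simp
    qed
    then have "X\<^sup>2 \<le> (real l)\<^sup>2" using X0 by (intro power_mono)
    then have "X\<^sup>2 \<le> 2 ^ l" using elim(1) by simp
    moreover have "X\<^sup>2 = 2 ^ l * (2 ^ l * F (G l) ^ 4)"
      by (simp add: X_def power2_eq_square power4_eq_xxxx)
    ultimately have "2 ^ l * F (G l) ^ 4 \<le> 1" by simp
    then show ?case by (simp add: field_simps power_one_over)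
  qed
qed

text \<open>The choice of \<open>m\<close> lets a union bound over \<open>O(n\<^bsup>d+1\<^esup>)\<close> rectangles, each containing \<open>m\<close>
  edges of weight at most \<open>g(n\<^bsup>1/8\<^esup>)\<close> with probability \<open>O(n\<^bsup>-m/32\<^esup>)\<close>, leave a factor \<open>1/n\<close>.\<close>

definition m :: nat where "m = 32 * (CARD('n) + 2)"
definition Q :: "int ^ 'n \<Rightarrow> ((int ^ 'n) \<times> 'n) set" where "Q x = cube (m + 2 * CARD('n) + 1) x \<times> UNIV"
definition corner :: "int ^ 'n \<Rightarrow> nat \<Rightarrow> int ^ 'n" where "corner z k = z + axis i (int (k * m))"

text \<open>The events \<open>crowded\<close>, \<open>blocked\<close> and \<open>resistive\<close>
  are the ways in which the hypotheses \<open>few\<close>, \<open>level\<close> and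
  \<open>row\<close> of \<open>spectral_bound\<close> can fail at scale 2^N.\<close>

definition crowded :: "nat \<Rightarrow> nat \<Rightarrow> 'a set" where
  "crowded q N = {\<omega> \<in> space M. \<exists>x\<in>cube (2 ^ N) 0. 2 * CARD('n) + 1 \<le> card {e \<in> Q x. W e \<omega> \<le> 4 ^ q * G N}}"

definition blocked :: "nat \<Rightarrow> 'a set" where
  "blocked N = {\<omega> \<in> space M. \<exists>(z, k)\<in>cube (2 * 2 ^ N) 0 \<times> {..2 ^ N}.
     m \<le> card {e \<in> rect m i i' (corner z k). W e \<omega> \<le> G (N div 8)}}"

definition mean :: "nat \<Rightarrow> nat \<Rightarrow> real" where
  "mean j N = 1 / G j + (\<Sum>l\<in>{j..<N div 8}. 2 ^ (4 * m\<^sup>2) * F (G l) ^ m / G (Suc l))"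

definition resistive :: "real \<Rightarrow> nat \<Rightarrow> nat \<Rightarrow> 'a set" where
  "resistive \<eta> j N = {\<omega> \<in> space M. \<exists>z\<in>cube (2 * 2 ^ N) 0.
     (\<Sum>k\<le>2 ^ N. resist G j (N div 8) m (rect m i i' (corner z k)) (\<lambda>e. W e \<omega>)) \<ge>
       (real (2 ^ N) + 1) * mean j N + 2 * (\<eta> / (8 * 4 ^ N * G N)) * real (2 ^ N)}"

lemma finite_Q [simp]: "finite (Q x)"
  by (simp add: Q_def card_cube)

lemma card_Q: "card (Q x) = card (Q 0)"
  by (simp add: Q_def card_cartesian_product card_cube)

lemma crowded_event: "crowded q N \<in> events"
  unfolding crowded_def by (intro sets.sets_Collect_finite_Ex closed_set_event card_cube) simp

lemma blocked_event: "blocked N \<in> events"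
  unfolding blocked_def split_def
  by (intro sets.sets_Collect_finite_Ex closed_set_event) (simp_all add: card_cube)

lemma resist_rv:
  assumes "finite K"
  shows "(\<lambda>\<omega>. resist s j J k K (\<lambda>e. W e \<omega>)) \<in> borel_measurable M"
proof -
  have "indep_vars (\<lambda>_. borel) (\<lambda>_ \<omega>. resist s j J k K (\<lambda>e. W e \<omega>)) {()}"
    using assms by (intro resist_indep) (auto simp: disjoint_family_on_def)
  then show ?thesis unfolding indep_vars_def by blast
qed

lemma resistive_event: "resistive \<eta> j N \<in> events"
proof -
  have [measurable]: "(\<lambda>\<omega>. resist G j (N div 8) m (rect m i i' c) (\<lambda>e. W e \<omega>)) \<in> borel_measurable M" for c
    by (rule resist_rv) simp
  show ?thesis unfolding resistive_def
    by (intro sets.sets_Collect_finite_Ex card_cube) measurable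
qed

text \<open>With exponent 2d the union bound over the box gives only the logarithm allowed by
  \<open>trap_density\<close>; the one additional closed edge supplies a factor exponentially small
  in \<open>N\<close>. A bound of order 1/N is enough because only square values of \<open>N\<close>
  will be used.\<close>

lemma crowded_bound: "\<exists>C. eventually (\<lambda>N. prob (crowded q N) \<le> C / real N) sequentially"
proof -
  define d where "d = CARD('n)"
  define c where "c = (3::real) ^ d * 2 ^ card (Q 0) * (2 ^ q) ^ d * 2 ^ q"
  have ev: "eventually (\<lambda>N. F (G (N - q)) ^ 4 \<le> (1 / 2) ^ (N - q)) sequentially"
    by (rule eventually_compose_filterlim[OF F_G_decay]) (rule filterlim_minus_const_nat_at_top)
  have ev': "eventually (\<lambda>N. (2 ^ (N - q)) ^ CARD('n) * F (G (N - q)) ^ (2 * CARD('n)) \<le> 1 * ln (real (N - q))) sequentially"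
    by (rule eventually_compose_filterlim[OF trap_density]) (auto intro: filterlim_minus_const_nat_at_top)
  have "eventually (\<lambda>N::nat. (real N) ^ 8 \<le> 2 ^ N) sequentially" by real_asymp
  then have "eventually (\<lambda>N. prob (crowded q N) \<le> c / real N) sequentially"
    using ev ev' eventually_ge_at_top[of "L + q + 1"]
  proof eventually_elim
    case (elim N)
    define p where "p = F (G (N - q))"
    have p0: "p \<ge> 0" by (simp add: p_def F_nonneg)
    have N1: "N \<ge> 1" "q \<le> N" "L \<le> N - q" using elim(4) by auto
    have "prob (crowded q N) \<le> real (card (cube (2 ^ N) (0 :: int ^ 'n))) * (2 ^ card (Q 0) * p ^ (2 * d + 1))"
      unfolding crowded_def
    proof (rule prob_Bex_le)
      fix x :: "int ^ 'n"
      have "prob {\<omega> \<in> space M. 2 * CARD('n) + 1 \<le> card {e \<in> Q x. W e \<omega> \<le> 4 ^ q * G N}} \<le>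
          2 ^ card (Q x) * F (4 ^ q * G N) ^ (2 * CARD('n) + 1)" by (rule prob_many_closed) simp
      also have "\<dots> \<le> 2 ^ card (Q 0) * p ^ (2 * d + 1)"
        unfolding card_Q[of x] p_def d_def using F_level[OF N1(2,3)] F_nonneg
        by (intro mult_left_mono power_mono) auto
      finally show "prob {\<omega> \<in> space M. 2 * CARD('n) + 1 \<le> card {e \<in> Q x. W e \<omega> \<le> 4 ^ q * G N}} \<le> 2 ^ card (Q 0) * p ^ (2 * d + 1)" .
    qed (auto intro: closed_set_event card_cube)
    also have "\<dots> \<le> (3 * 2 ^ N) ^ d * (2 ^ card (Q 0) * p ^ (2 * d + 1))"
      using card_cube_le[where c = 1 and N = N and 'n = 'n] p0 by (intro mult_right_mono) (auto simp: d_def)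
    also have "\<dots> = 3 ^ d * 2 ^ card (Q 0) * ((2 ^ N) ^ d * p ^ (2 * d)) * p"
      by (simp add: power_mult_distrib power_add)
    also have "(2::real) ^ N = 2 ^ q * 2 ^ (N - q)" using N1 by (simp flip: power_add)
    also have "(2 ^ q * 2 ^ (N - q)) ^ d * p ^ (2 * d) = (2 ^ q) ^ d * ((2 ^ (N - q)) ^ d * p ^ (2 * d))"
      by (simp add: power_mult_distrib)
    also have "3 ^ d * 2 ^ card (Q 0) * ((2 ^ q) ^ d * ((2 ^ (N - q)) ^ d * p ^ (2 * d))) * p \<le>
       3 ^ d * 2 ^ card (Q 0) * ((2 ^ q) ^ d * real N) * (2 ^ q / (real N)\<^sup>2)"
    proof (intro mult_mono mult_nonneg_nonneg)
      have "(2 ^ (N - q)) ^ d * p ^ (2 * d) \<le> ln (real (N - q))" using elim(3) by (simp add: d_def p_def)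
      also have "\<dots> \<le> real (N - q)" using ln_le_minus_one[of "real (N - q)"] elim(4) by simp
      finally show "(2 ^ (N - q)) ^ d * p ^ (2 * d) \<le> real N" by simp
      have "p ^ 4 \<le> (1 / 2) ^ (N - q)" using elim(2) by (simp add: p_def)
      also have "\<dots> = 2 ^ q / 2 ^ N" using N1 by (simp add: power_one_over power_diff)
      also have "\<dots> \<le> (2 ^ q) ^ 4 / (real N) ^ 8"
        using elim(1) N1 by (intro frac_le self_le_power) auto
      also have "\<dots> = (2 ^ q / (real N)\<^sup>2) ^ 4" by (simp add: power_divide)
      finally show "p \<le> 2 ^ q / (real N)\<^sup>2"
        using power_le_imp_le_base[of p 3 "2 ^ q / (real N)\<^sup>2"] by simp
    qed (use p0 in auto)
    also have "\<dots> = c / real N" using N1 by (simp add: c_def power2_eq_square)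
    finally show ?case .
  qed
  then show ?thesis by blast
qed

lemma blocked_bound: "\<exists>C. eventually (\<lambda>N. prob (blocked N) \<le> C / real N) sequentially"
proof -
  define d where "d = CARD('n)"
  define c where "c = (5::real) ^ d * 2 * 2 ^ (4 * m\<^sup>2) * (2 ^ 8) ^ (d + 2)"
  have ev: "eventually (\<lambda>N. F (G (N div 8)) ^ 4 \<le> (1 / 2) ^ (N div 8)) sequentially"
    by (rule eventually_compose_filterlim[OF F_G_decay]) (rule filterlim_at_top_div_const_nat, simp)
  have "eventually (\<lambda>N. prob (blocked N) \<le> c / real N) sequentially"
    using ev eventually_ge_at_top[of 1]
  proof eventually_elim
    case (elim N)
    define J where "J = N div 8"
    have "prob (blocked N) \<le> real (card (cube (2 * 2 ^ N) (0 :: int ^ 'n) \<times> {..(2::nat) ^ N})) * (2 ^ (4 * m\<^sup>2) * F (G J) ^ m)"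
      unfolding blocked_def split_def J_def[symmetric]
    proof (rule prob_Bex_le)
      fix x :: "(int ^ 'n) \<times> nat"
      have "prob {\<omega> \<in> space M. m \<le> card {e \<in> rect m i i' (corner (fst x) (snd x)). W e \<omega> \<le> G J}} \<le>
        2 ^ card (rect m i i' (corner (fst x) (snd x))) * F (G J) ^ m" by (rule prob_many_closed) simp
      also have "\<dots> \<le> 2 ^ (4 * m\<^sup>2) * F (G J) ^ m"
        using F_nonneg card_rect_le by (intro mult_right_mono power_increasing) auto
      finally show "prob {\<omega> \<in> space M. m \<le> card {e \<in> rect m i i' (corner (fst x) (snd x)). W e \<omega> \<le> G J}} \<le> 2 ^ (4 * m\<^sup>2) * F (G J) ^ m" .
    qed (auto intro: closed_set_event card_cube)
    also have "\<dots> \<le> (5 * 2 ^ N) ^ d * (2 * 2 ^ N) * (2 ^ (4 * m\<^sup>2) * ((2 ^ 8) ^ (d + 2) / (2 ^ N) ^ (d + 2)))"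
    proof (intro mult_mono mult_nonneg_nonneg)
      have "real (2 ^ N + 1) \<le> 2 * 2 ^ N" using one_le_power[of "2::real" N] by simp
      moreover have "real (card (cube (2 * 2 ^ N) (0 :: int ^ 'n))) \<le> (5 * 2 ^ N) ^ d"
        using card_cube_le[where c = 2 and N = N and 'n = 'n] by (simp add: d_def)
      ultimately show "real (card (cube (2 * 2 ^ N) (0 :: int ^ 'n) \<times> {..(2::nat) ^ N})) \<le> (5 * 2 ^ N) ^ d * (2 * 2 ^ N)"
        unfolding card_cartesian_product of_nat_mult by (intro mult_mono) auto
      have "F (G J) ^ m = (F (G J) ^ 4) ^ (8 * (d + 2))" by (simp add: m_def d_def flip: power_mult)
      also have "\<dots> \<le> ((1 / 2) ^ J) ^ (8 * (d + 2))" using elim(1) by (intro power_mono) (auto simp: J_def)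
      also have "\<dots> = ((1 / 2) ^ (8 * J)) ^ (d + 2)" by (simp only: power_mult[symmetric] mult_ac)
      \<comment> \<open>Rounding in \<open>N div 8\<close> leaves only
        \<open>N \<le> 8 * (J + 1)\<close>, at the cost of the constant
        \<open>2 ^ 8\<close>.\<close>
      also have "(1 / 2 :: real) ^ (8 * J) = 2 ^ 8 / 2 ^ (8 * (J + 1))" by (simp add: power_one_over power_add)
      also have "(2 ^ 8 / 2 ^ (8 * (J + 1))) ^ (d + 2) \<le> (2 ^ 8 / (2 :: real) ^ N) ^ (d + 2)"
        by (intro power_mono divide_left_mono power_increasing) (auto simp: J_def)
      finally show "F (G J) ^ m \<le> (2 ^ 8) ^ (d + 2) / (2 ^ N) ^ (d + 2)" by (simp only: power_divide)
    qed (use F_nonneg in auto)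
    also have "\<dots> = c / 2 ^ N" by (simp add: c_def power_mult_distrib field_simps power_add)
    also have "\<dots> \<le> c / real N" using elim(2) of_nat_less_two_power[of N, where ?'a = real]
      by (intro divide_left_mono) (auto simp: c_def)
    finally show ?case .
  qed
  then show ?thesis by blast
qed

text \<open>In the unit of \<open>G_ratio'\<close> the summand at level \<open>l\<close> is of order
  at most 8^(-l) 4^l, so the tail from \<open>j\<close> on is small uniformly in \<open>N\<close>.
  The start \<open>j\<close> is fixed before \<open>N\<close>; the leading term
  \<open>1 / G j\<close> then disappears by \<open>G_lim\<close>.\<close>

lemma mean_small:
  assumes \<eta>: "\<eta> > 0"
  shows "\<exists>j\<ge>L. eventually (\<lambda>N. 4 ^ N * G N * mean j N \<le> \<eta> / 8) sequentially"
proof -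
  define c where "c = (2::real) ^ (4 * m\<^sup>2)"
  have c0: "c > 0" by (simp add: c_def)
  have "(\<lambda>j. 8 * c * (1 / 2) ^ j) \<longlonglongrightarrow> 8 * c * 0"
    by (intro tendsto_intros LIMSEQ_realpow_zero) auto
  then have "eventually (\<lambda>j. 8 * c * (1 / 2) ^ j < \<eta> / 16) sequentially"
    by (rule order_tendstoD) (use \<eta> in simp)
  moreover have "eventually (\<lambda>j. \<forall>l\<ge>j. F (G l) ^ 4 \<le> (1 / 2) ^ l) sequentially"
    using F_G_decay by (rule eventually_all_ge_at_top)
  ultimately have "eventually (\<lambda>j. j \<ge> L \<and> 8 * c * (1 / 2) ^ j < \<eta> / 16 \<and> (\<forall>l\<ge>j. F (G l) ^ 4 \<le> (1 / 2) ^ l)) sequentially"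
    using eventually_ge_at_top[of L] by eventually_elim auto
  then obtain j where j: "j \<ge> L" "8 * c * (1 / 2) ^ j < \<eta> / 16" "\<And>l. l \<ge> j \<Longrightarrow> F (G l) ^ 4 \<le> (1 / 2) ^ l"
    unfolding eventually_sequentially by blast
  have "(\<lambda>N. 4 ^ N * G N / G j) \<longlonglongrightarrow> 0 / G j" using G_lim G_pos[of j] by (intro tendsto_intros) auto
  then have "eventually (\<lambda>N. 4 ^ N * G N / G j < \<eta> / 16) sequentially"
    by (rule order_tendstoD) (use \<eta> in simp)
  then have "eventually (\<lambda>N. 4 ^ N * G N * mean j N \<le> \<eta> / 8) sequentially"
    using eventually_ge_at_top[of 1]
  proof eventually_elim
    case (elim N)
    have geo: "(\<Sum>l\<in>{j..<J}. (1 / 2 :: real) ^ l) \<le> 2 * (1 / 2) ^ j" for J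
    proof (cases "j \<le> J")
      case True
      then have "(\<Sum>l\<in>{j..<J}. (1 / 2 :: real) ^ l) = 2 * (1 / 2) ^ j - 2 * (1 / 2) ^ J"
        by (induction J rule: dec_induct) (auto simp: sum.atLeastLessThan_Suc)
      then show ?thesis by simp
    qed simp
    have "4 ^ N * G N * mean j N = 4 ^ N * G N / G j +
        (\<Sum>l\<in>{j..<N div 8}. c * F (G l) ^ m * (4 ^ N * G N / G (Suc l)))"
      by (simp add: mean_def c_def distrib_left sum_distrib_left mult_ac)
    also have "(\<Sum>l\<in>{j..<N div 8}. c * F (G l) ^ m * (4 ^ N * G N / G (Suc l))) \<le>
        (\<Sum>l\<in>{j..<N div 8}. c * (1 / 8) ^ l * 4 ^ Suc l)"
    proof (intro sum_mono mult_mono mult_left_mono)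
      fix l assume l: "l \<in> {j..<N div 8}"
      \<comment> \<open>Twelve factors suffice: they give the rate 1/8 per level, which beats the
        growth \<open>4 ^ l\<close>.\<close>
      have "F (G l) ^ m \<le> F (G l) ^ 12" by (intro power_decreasing F_nonneg F_le_1) (simp add: m_def)
      also have "\<dots> = (F (G l) ^ 4) ^ 3" by (simp flip: power_mult)
      also have "\<dots> \<le> ((1 / 2) ^ l) ^ 3" using l by (intro power_mono j F_nonneg zero_le_power) auto
      also have "\<dots> = ((1 / 2) ^ 3) ^ l" by (simp only: power_mult[symmetric] mult.commute)
      also have "(1 / 2 :: real) ^ 3 = 1 / 8" by (simp add: power3_eq_cube)
      finally show "F (G l) ^ m \<le> (1 / 8) ^ l" .
      show "4 ^ N * G N / G (Suc l) \<le> 4 ^ Suc l"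
        using l j by (intro G_ratio') auto
    qed (use c0 G_pos F_nonneg in \<open>auto simp: less_imp_le\<close>)
    also have "\<dots> = 4 * c * (\<Sum>l\<in>{j..<N div 8}. (1 / 2) ^ l)"
    proof -
      have "(1 / 8 :: real) ^ l * 4 ^ l = (1 / 2) ^ l" for l by (simp flip: power_mult_distrib)
      then show ?thesis by (simp add: sum_distrib_left mult_ac)
    qed
    also have "\<dots> \<le> 4 * c * (2 * (1 / 2) ^ j)" using geo c0 by (intro mult_left_mono) auto
    finally have "4 ^ N * G N * mean j N \<le> 4 ^ N * G N / G j + 4 * c * (2 * (1 / 2) ^ j)" by simp
    then show ?case using elim(1) j(2) by argo
  qed
  then show ?thesis using j(1) by blast
qed

text \<open>The cap \<open>B\<close> is at most \<open>2 * 4 ^ J\<close> in the unit of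
  \<open>G_ratio'\<close>. Since \<open>8 * J \<le> N\<close>, the Hoeffding exponent is at least of
  order 2^N / 16^J, hence of order 2^(N/2), and the exponential beats the number of rows.\<close>

lemma resistive_bound:
  assumes \<eta>: "\<eta> > 0" and j: "L \<le> j"
  shows "\<exists>C. eventually (\<lambda>N. prob (resistive \<eta> j N) \<le> C / real N) sequentially"
proof -
  define d where "d = CARD('n)"
  \<comment> \<open>The Hoeffding exponent \<open>y\<close> has a square of order at least
    \<open>2 ^ N\<close>, so its power \<open>2 * (d + 1)\<close> yields \<open>d + 1\<close>
    factors \<open>2 ^ N\<close>, one more than the count of row starts.\<close>
  define p where "p = 2 * (d + 1)"
  define b where "b = (\<eta> / 16)\<^sup>2"
  define c where "c = 5 ^ d * 2 * ((real p)\<^sup>2 / b\<^sup>2) ^ (d + 1)"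
  have b0: "b > 0" using \<eta> by (simp add: b_def)
  have "eventually (\<lambda>N. prob (resistive \<eta> j N) \<le> c / real N) sequentially"
    using eventually_ge_at_top[of "8 * j + 1"]
  proof eventually_elim
    case (elim N)
    define J where "J = N div 8"
    have J: "j \<le> J" "J \<le> N" "8 * J \<le> N" using elim by (auto simp: J_def)
    define \<epsilon> where "\<epsilon> = \<eta> / (8 * 4 ^ N * G N)"
    have \<epsilon>: "\<epsilon> > 0" using \<eta> G_pos by (simp add: \<epsilon>_def)
    define B where "B = 1 / G j + (\<Sum>l\<in>{j..<J}. 1 / G (Suc l))"
    have Bpos: "B > 0" unfolding B_def using G_pos by (intro add_pos_nonneg sum_nonneg) (auto simp: less_imp_le)
    define y where "y = \<epsilon>\<^sup>2 * 2 ^ N / B\<^sup>2"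
    have "prob (resistive \<eta> j N) \<le> real (card (cube (2 * 2 ^ N) (0 :: int ^ 'n))) * (2 * exp (- y))"
      unfolding resistive_def J_def[symmetric]
    proof (rule prob_Bex_le)
      fix z :: "int ^ 'n"
      have [measurable]: "(\<lambda>\<omega>. resist G j J m (rect m i i' c) (\<lambda>e. W e \<omega>)) \<in> borel_measurable M" for c
        by (rule resist_rv) simp
      show "{\<omega> \<in> space M. (real (2 ^ N) + 1) * mean j N + 2 * (\<eta> / (8 * 4 ^ N * G N)) * real (2 ^ N)
           \<le> (\<Sum>k\<le>2 ^ N. resist G j J m (rect m i i' (corner z k)) (\<lambda>e. W e \<omega>))} \<in> events"
        by measurable
      have "prob {\<omega> \<in> space M. (real (2 ^ N) + 1) * mean j N + 2 * \<epsilon> * real (2 ^ N)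
           \<le> (\<Sum>k\<le>2 ^ N. resist G j J m (rect m i i' (z + axis i (int (k * m)))) (\<lambda>e. W e \<omega>))}
           \<le> 2 * exp (- \<epsilon>\<^sup>2 * real (2 ^ N) / B\<^sup>2)"
        by (rule prob_row_resist[OF G_pos axes _ \<epsilon> B_def]) (auto simp: mean_def J_def)
      then show "prob {\<omega> \<in> space M. (real (2 ^ N) + 1) * mean j N + 2 * (\<eta> / (8 * 4 ^ N * G N)) * real (2 ^ N)
           \<le> (\<Sum>k\<le>2 ^ N. resist G j J m (rect m i i' (corner z k)) (\<lambda>e. W e \<omega>))} \<le> 2 * exp (- y)"
        by (simp add: y_def \<epsilon>_def corner_def)
    qed (rule card_cube)
    also have "\<dots> \<le> (5 * 2 ^ N) ^ d * (2 * (((real p)\<^sup>2 / b\<^sup>2) ^ (d + 1) / (2 ^ N) ^ (d + 1)))"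
    proof (intro mult_mono mult_left_mono)
      show "real (card (cube (2 * 2 ^ N) (0 :: int ^ 'n))) \<le> (5 * 2 ^ N) ^ d"
        using card_cube_le[where c = 2 and N = N and 'n = 'n] by (simp add: d_def)
      have "4 ^ N * G N * B = 4 ^ N * G N / G j + (\<Sum>l\<in>{j..<J}. 4 ^ N * G N / G (Suc l))"
        by (simp add: B_def distrib_left sum_distrib_left)
      also have "\<dots> \<le> 4 ^ j + (\<Sum>l\<in>{j..<J}. 4 ^ Suc l)"
        using j J by (intro add_mono sum_mono G_ratio') auto
      also have "\<dots> \<le> 2 * 4 ^ J"
        using J(1) by (induction J rule: dec_induct) (auto simp: sum.atLeastLessThan_Suc elim!: order_trans)
      finally have BJ: "4 ^ N * G N * B \<le> 2 * 4 ^ J" .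
      have "\<eta> / (16 * 4 ^ J) \<le> \<eta> / (8 * (4 ^ N * G N * B))"
        using BJ \<eta> Bpos G_pos[of N] by (intro divide_left_mono mult_pos_pos) (auto simp: mult_ac)
      also have "\<dots> = \<epsilon> / B" by (simp add: \<epsilon>_def)
      finally have "(\<eta> / (16 * 4 ^ J))\<^sup>2 \<le> (\<epsilon> / B)\<^sup>2" using \<eta> by (intro power_mono) auto
      then have "(\<eta> / (16 * 4 ^ J))\<^sup>2 * 2 ^ N \<le> (\<epsilon> / B)\<^sup>2 * 2 ^ N" by (rule mult_right_mono) simp
      also have "\<dots> = y" by (simp add: y_def power_divide)
      finally have "(\<eta> / (16 * 4 ^ J))\<^sup>2 * 2 ^ N \<le> y" .
      moreover have "(\<eta> / (16 * 4 ^ J))\<^sup>2 * 2 ^ N = b * (2 ^ N / 16 ^ J)"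
        by (simp add: b_def power_divide power_mult_distrib) (simp flip: power_mult power_mult_distrib add: power2_eq_square)
      ultimately have "b * (2 ^ N / 16 ^ J) \<le> y" by simp
      then have "(b * (2 ^ N / 16 ^ J))\<^sup>2 \<le> y\<^sup>2" using b0 by (intro power_mono) auto
      moreover have "b\<^sup>2 * 2 ^ N \<le> (b * (2 ^ N / 16 ^ J))\<^sup>2"
      proof -
        have "((16::real) ^ J)\<^sup>2 = (16\<^sup>2) ^ J" by (simp only: power_mult[symmetric] mult.commute)
        also have "\<dots> = (2 ^ 8) ^ J" by simp
        also have "\<dots> = 2 ^ (8 * J)" by (simp only: power_mult)
        also have "\<dots> \<le> 2 ^ N" using J by (intro power_increasing) auto
        finally have "2 ^ N * ((16::real) ^ J)\<^sup>2 \<le> 2 ^ N * 2 ^ N" by (intro mult_left_mono) auto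
        then have "(2::real) ^ N \<le> (2 ^ N / 16 ^ J)\<^sup>2" by (simp add: power_divide field_simps power2_eq_square)
        then show ?thesis by (simp only: power_mult_distrib) (intro mult_left_mono, auto)
      qed
      ultimately have y2: "b\<^sup>2 * 2 ^ N \<le> y\<^sup>2" by simp
      have y0: "y \<ge> 0" by (simp add: y_def)
      have p0: "p > 0" by (simp add: p_def)
      have "(b\<^sup>2 * 2 ^ N / (real p)\<^sup>2) ^ (d + 1) \<le> (y\<^sup>2 / (real p)\<^sup>2) ^ (d + 1)"
        using y2 by (intro power_mono divide_right_mono) auto
      also have "\<dots> = (y / real p) ^ p" by (simp only: p_def power_mult power_divide)
      also have "\<dots> \<le> exp y" by (rule power_le_exp[OF y0 p0])
      finally have "inverse (exp y) \<le> inverse ((b\<^sup>2 * 2 ^ N / (real p)\<^sup>2) ^ (d + 1))"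
        using b0 p0 by (intro le_imp_inverse_le) auto
      also have "\<dots> = ((real p)\<^sup>2 / b\<^sup>2) ^ (d + 1) / (2 ^ N) ^ (d + 1)"
        by (simp only: power_inverse[symmetric] power_divide[symmetric]) (simp add: field_simps)
      finally show "exp (- y) \<le> ((real p)\<^sup>2 / b\<^sup>2) ^ (d + 1) / (2 ^ N) ^ (d + 1)" by (simp only: exp_minus)
    qed auto
    also have "\<dots> = c / 2 ^ N" by (simp add: c_def power_mult_distrib field_simps)
    also have "\<dots> \<le> c / real N" using elim of_nat_less_two_power[of N, where ?'a = real]
      by (intro divide_left_mono) (auto simp: c_def)
    finally show ?case .
  qed
  then show ?thesis by blast
qed

end

section \<open>Escaping infinitely often\<close>

context dyadic_weights begin

text \<open>The local lemma gives \<open>(1 - 2 * x) ^ card S\<close>, which is at least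
  \<open>exp (- 4 * x * card S)\<close>, and the trap density makes \<open>x * card S\<close> an
  arbitrarily small multiple of \<open>ln N\<close>. The rate 1/2 is chosen because the bound
  becomes exactly 1/k at N = k^2. Subsets \<open>S\<close> are allowed since only a ring has to be
  free of traps.\<close>

lemma escapes_lower_bound:
  "eventually (\<lambda>N. \<forall>S \<subseteq> cube (2 ^ N) 0. prob (escapes (4 ^ q * G N) S) \<ge> exp (- ln (real N) / 2)) sequentially"
proof -
  define d where "d = CARD('n)"
  \<comment> \<open>Cancels \<open>3 ^ d\<close> from the size of the box and
    \<open>(2 ^ q) ^ d\<close> from the shift of scale; the 8 remains as
    \<open>ln N / 8\<close>.\<close>
  define \<epsilon> where "\<epsilon> = 1 / (8 * 3 ^ d * (2 ^ q) ^ d :: real)"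
  have \<epsilon>: "\<epsilon> > 0" by (simp add: \<epsilon>_def)
  have ev: "eventually (\<lambda>N. F (G (N - q)) ^ 4 \<le> (1 / 2) ^ (N - q)) sequentially"
    by (rule eventually_compose_filterlim[OF F_G_decay]) (rule filterlim_minus_const_nat_at_top)
  have ev': "eventually (\<lambda>N. (2 ^ (N - q)) ^ CARD('n) * F (G (N - q)) ^ (2 * CARD('n)) \<le> \<epsilon> * ln (real (N - q))) sequentially"
    by (rule eventually_compose_filterlim[OF trap_density[OF \<epsilon>]]) (rule filterlim_minus_const_nat_at_top)
  have "(\<lambda>l. (1 / 2 :: real) ^ l) \<longlonglongrightarrow> 0" by (rule LIMSEQ_realpow_zero) auto
  then have "eventually (\<lambda>l. (1 / 2 :: real) ^ l < 1 / (4 * 3 ^ d)) sequentially"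
    by (rule order_tendstoD) simp
  then have ev2: "eventually (\<lambda>N. (1 / 2 :: real) ^ (N - q) < 1 / (4 * 3 ^ d)) sequentially"
    by (rule eventually_compose_filterlim) (rule filterlim_minus_const_nat_at_top)
  show ?thesis
    using ev ev' ev2 eventually_ge_at_top[of "L + q + 1"]
  proof eventually_elim
    case (elim N)
    define p where "p = F (G (N - q))"
    define x where "x = F (4 ^ q * G N) ^ (2 * d)"
    have N: "q \<le> N" "L \<le> N - q" "N - q \<ge> 1" using elim(4) by auto
    have p: "0 \<le> p" "p \<le> 1" by (auto simp: p_def F_nonneg F_le_1)
    have x0: "x \<ge> 0" by (simp add: x_def F_nonneg)
    have xp: "x \<le> p ^ (2 * d)" unfolding x_def p_def by (intro power_mono F_level N F_nonneg)
    also have "\<dots> \<le> p ^ 4" using p dim by (intro power_decreasing) (auto simp: d_def)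
    also have "\<dots> < 1 / (4 * 3 ^ d)" using elim(1,3) by (simp add: p_def)
    finally have small: "4 * 3 ^ d * x \<le> 1" by (simp add: field_simps)
    have "4 * 1 * x \<le> 4 * 3 ^ d * x" using x0 by (intro mult_right_mono mult_left_mono) auto
    then have x4: "4 * x \<le> 1" using small by simp
    have ex: "exp (- 4 * x) \<le> 1 - 2 * x"
    proof -
      have "exp (- 4 * x) = inverse (exp (4 * x))" by (simp add: exp_minus)
      also have "\<dots> \<le> inverse (1 + 4 * x)" using x0 exp_ge_add_one_self[of "4 * x"] by (intro le_imp_inverse_le) auto
      also have "\<dots> \<le> 1 - 2 * x"
      proof -
        have "x * (8 * x) \<le> x * 2" using x0 x4 by (intro mult_left_mono) auto
        then have "1 \<le> (1 - 2 * x) * (1 + 4 * x)" by (simp add: algebra_simps)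
        then show ?thesis using x0 by (simp add: field_simps)
      qed
      finally show ?thesis .
    qed
    show ?case
    proof (intro allI impI)
      fix S :: "(int ^ 'n) set" assume S: "S \<subseteq> cube (2 ^ N) 0"
      have finS: "finite S" using S card_cube(1) by (rule finite_subset)
      have "real (card S) \<le> real (card (cube (2 ^ N) (0 :: int ^ 'n)))"
        using card_mono[OF card_cube(1) S] by simp
      also have "\<dots> \<le> (3 * 2 ^ N) ^ d" using card_cube_le[where c = 1 and N = N and 'n = 'n] by (simp add: d_def)
      finally have cS: "real (card S) \<le> (3 * 2 ^ N) ^ d" .
      have "real (card S) * x \<le> (3 * 2 ^ N) ^ d * p ^ (2 * d)"
        using cS xp x0 by (intro mult_mono) auto
      also have "(2::real) ^ N = 2 ^ q * 2 ^ (N - q)" using N by (simp flip: power_add)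
      also have "(3 * (2 ^ q * 2 ^ (N - q))) ^ d * p ^ (2 * d) = 3 ^ d * (2 ^ q) ^ d * ((2 ^ (N - q)) ^ d * p ^ (2 * d))"
        by (simp add: power_mult_distrib)
      also have "\<dots> \<le> 3 ^ d * (2 ^ q) ^ d * (\<epsilon> * ln (real N))"
      proof (rule mult_left_mono)
        have "(2 ^ (N - q)) ^ d * p ^ (2 * d) \<le> \<epsilon> * ln (real (N - q))" using elim(2) by (simp add: d_def p_def)
        also have "\<dots> \<le> \<epsilon> * ln (real N)" using \<epsilon> N by (intro mult_left_mono) (auto simp: ln_le_cancel_iff)
        finally show "(2 ^ (N - q)) ^ d * p ^ (2 * d) \<le> \<epsilon> * ln (real N)" .
      qed simp
      also have "\<dots> = ln (real N) / 8" by (simp add: \<epsilon>_def)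
      finally have cx: "real (card S) * x \<le> ln (real N) / 8" .
      have "exp (- ln (real N) / 2) \<le> exp (real (card S) * (- 4 * x))" using cx by simp
      also have "\<dots> = exp (- 4 * x) ^ card S" by (rule exp_of_nat_mult)
      also have "\<dots> \<le> (1 - 2 * x) ^ card S" using ex by (intro power_mono) auto
      also have "\<dots> \<le> prob (escapes (4 ^ q * G N) S)"
        using prob_escapes_ge[OF _ finS] small unfolding x_def d_def by blast
      finally show "prob (escapes (4 ^ q * G N) S) \<ge> exp (- ln (real N) / 2)" .
    qed
  qed
qed

text \<open>One layer more than the previous box is removed, so that a star based in
  \<open>ring k\<close> shares no edge with a star of an earlier ring.\<close>

definition inner :: "nat \<Rightarrow> (int ^ 'n) set" where "inner k = cube (2 ^ ((k - 1)\<^sup>2) + 1) 0"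
definition ring :: "nat \<Rightarrow> (int ^ 'n) set" where "ring k = cube (2 ^ (k\<^sup>2)) 0 - inner k"
definition inner_trap :: "nat \<Rightarrow> nat \<Rightarrow> 'a set" where
  "inner_trap q k = {\<omega> \<in> space M. \<exists>x\<in>inner k. \<forall>e\<in>star x. W e \<omega> \<le> 4 ^ q * G (k\<^sup>2)}"

lemma inner_trap_event: "inner_trap q k \<in> events"
proof -
  have "{\<omega> \<in> space M. \<forall>e\<in>star x. W e \<omega> \<le> s} \<in> events" for x s
    using traps_event[of s x] by (simp add: traps_def)
  then show ?thesis unfolding inner_trap_def inner_def by (intro sets.sets_Collect_finite_Ex card_cube)
qed

lemma filterlim_square: "filterlim (\<lambda>k::nat. k\<^sup>2) sequentially sequentially"
  by (rule filterlim_at_top_mono[OF filterlim_ident]) (auto intro!: always_eventually simp: power2_eq_square)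

text \<open>The threshold belongs to scale k^2, while the sites lie in a box of scale (k-1)^2. The
  volume ratio, of order 4^(-kd), outweighs the trap density, which is bounded by k^2 up to a
  constant.\<close>

lemma inner_trap_bound: "\<exists>C. eventually (\<lambda>k. prob (inner_trap q k) \<le> C / (real k)\<^sup>2) sequentially"
proof -
  define d where "d = CARD('n)"
  define c where "c = (2::real) * (5 ^ d * (2 ^ q) ^ d)"
  have "eventually (\<lambda>N. (2 ^ (N - q)) ^ CARD('n) * F (G (N - q)) ^ (2 * CARD('n)) \<le> 1 * ln (real (N - q))) sequentially"
    by (rule eventually_compose_filterlim[OF trap_density]) (auto intro: filterlim_minus_const_nat_at_top)
  then have ev: "eventually (\<lambda>k. (2 ^ (k\<^sup>2 - q)) ^ CARD('n) * F (G (k\<^sup>2 - q)) ^ (2 * CARD('n)) \<le> 1 * ln (real (k\<^sup>2 - q))) sequentially"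
    by (rule eventually_compose_filterlim[OF _ filterlim_square])
  have "eventually (\<lambda>k::nat. (real k) ^ 4 \<le> 4 ^ k) sequentially" by real_asymp
  then have "eventually (\<lambda>k. prob (inner_trap q k) \<le> c / (real k)\<^sup>2) sequentially"
    using ev eventually_ge_at_top[of "L + q + 1"]
  proof eventually_elim
    case (elim k)
    define N where "N = k\<^sup>2"
    define p where "p = F (G (N - q))"
    have k1: "k \<ge> 1" using elim by simp
    have "k \<le> N" by (simp add: N_def power2_eq_square)
    then have N: "q \<le> N" "L \<le> N - q" "N - q \<ge> 1" using elim(3) by auto
    have "prob (inner_trap q k) \<le> real (card (inner k)) * p ^ (2 * d)"
      unfolding inner_trap_def
    proof (rule prob_Bex_le)
      fix x :: "int ^ 'n"
      show "{\<omega> \<in> space M. \<forall>e\<in>star x. W e \<omega> \<le> 4 ^ q * G (k\<^sup>2)} \<in> events"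
        using traps_event[of "4 ^ q * G (k\<^sup>2)" x] by (simp add: traps_def)
      have "prob {\<omega> \<in> space M. \<forall>e\<in>star x. W e \<omega> \<le> 4 ^ q * G (k\<^sup>2)} = F (4 ^ q * G N) ^ (2 * d)"
        using prob_traps[of "4 ^ q * G (k\<^sup>2)" x] by (simp add: traps_def d_def N_def)
      also have "\<dots> \<le> p ^ (2 * d)" unfolding p_def by (intro power_mono F_level N F_nonneg)
      finally show "prob {\<omega> \<in> space M. \<forall>e\<in>star x. W e \<omega> \<le> 4 ^ q * G (k\<^sup>2)} \<le> p ^ (2 * d)" .
    qed (simp add: inner_def card_cube)
    also have "\<dots> \<le> (5 * 2 ^ ((k - 1)\<^sup>2)) ^ d * ((2 ^ q) ^ d * (real N / (2 ^ N) ^ d))"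
    proof (intro mult_mono)
      have "2 * (2 ^ ((k - 1)\<^sup>2) + 1) + 1 \<le> 5 * (2::real) ^ ((k - 1)\<^sup>2)"
        using one_le_power[of "2::real" "(k - 1)\<^sup>2"] by simp
      then have "(2 * (2 ^ ((k - 1)\<^sup>2) + 1) + 1) ^ d \<le> (5 * (2::real) ^ ((k - 1)\<^sup>2)) ^ d"
        by (rule power_mono) simp
      then show "real (card (inner k)) \<le> (5 * 2 ^ ((k - 1)\<^sup>2)) ^ d"
        by (simp add: inner_def card_cube d_def add_ac)
      have "(2 ^ (N - q)) ^ d * p ^ (2 * d) \<le> ln (real (N - q))" using elim(2) by (simp add: d_def p_def N_def)
      also have "\<dots> \<le> real (N - q)" using N(3) by (intro order_trans[OF ln_le_minus_one]) auto
      finally have "(2 ^ (N - q)) ^ d * p ^ (2 * d) \<le> real N" by simp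
      then have "(2 ^ q) ^ d * ((2 ^ (N - q)) ^ d * p ^ (2 * d)) \<le> (2 ^ q) ^ d * real N" by (intro mult_left_mono) auto
      also have "(2 ^ q) ^ d * ((2 ^ (N - q)) ^ d * p ^ (2 * d)) = (2 ^ N) ^ d * p ^ (2 * d)"
        using N by (simp add: mult.assoc[symmetric] flip: power_mult_distrib power_add)
      finally show "p ^ (2 * d) \<le> (2 ^ q) ^ d * (real N / (2 ^ N) ^ d)" by (simp add: field_simps)
    qed (auto simp: p_def F_nonneg)
    also have "\<dots> = 5 ^ d * (2 ^ q) ^ d * real N * (2 ^ ((k - 1)\<^sup>2) / 2 ^ N) ^ d"
      by (simp add: power_mult_distrib power_divide)
    also have "(2::real) ^ ((k - 1)\<^sup>2) / 2 ^ N = 2 / 4 ^ k"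
    proof -
      have "(k - 1)\<^sup>2 + 2 * k = N + 1" using k1 by (cases k) (auto simp: N_def power2_eq_square)
      moreover have "(4::real) ^ k = 2 ^ (2 * k)" by (simp add: power_mult)
      ultimately have "(2::real) ^ ((k - 1)\<^sup>2) * 4 ^ k = 2 ^ (N + 1)" by (simp only: power_add[symmetric])
      then show ?thesis by (simp add: field_simps)
    qed
    also have "5 ^ d * (2 ^ q) ^ d * real N * (2 / 4 ^ k) ^ d \<le> 5 ^ d * (2 ^ q) ^ d * real N * (2 / 4 ^ k)"
    proof (rule mult_left_mono)
      have "(4::real) ^ 1 \<le> 4 ^ k" using k1 by (intro power_increasing) auto
      then have "(2::real) / 4 ^ k \<le> 1" by simp
      then show "(2 / 4 ^ k) ^ d \<le> 2 / (4::real) ^ k" using dim by (intro power_le_one_iff[THEN iffD2] self_le_power power_decreasing[of 1 d "2 / 4 ^ k", simplified]) (auto simp: d_def)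
    qed simp
    also have "\<dots> = c * ((real k)\<^sup>2 / 4 ^ k)" by (simp add: c_def N_def)
    also have "\<dots> \<le> c * ((real k)\<^sup>2 / (real k) ^ 4)"
      using elim(1) k1 by (intro mult_left_mono divide_left_mono) (auto simp: c_def)
    also have "\<dots> = c / (real k)\<^sup>2" using k1 by (simp add: power2_eq_square power4_eq_xxxx)
    finally show ?case .
  qed
  then show ?thesis by blast
qed

lemma rings_indep:
  assumes "finite J"
  shows "prob {\<omega> \<in> space M. \<forall>k\<in>J. \<omega> \<notin> escapes (a k) (ring k)} = (\<Prod>k\<in>J. prob {\<omega> \<in> space M. \<omega> \<notin> escapes (a k) (ring k)})"
proof -
  have disj: "star x \<inter> star y = {}" if "k < l" "x \<in> ring k" "y \<in> ring l" for k l x y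
  proof (rule ccontr)
    assume "star x \<inter> star y \<noteq> {}"
    then have y: "y \<in> cube 1 x" by (rule star_overlap)
    have "k\<^sup>2 \<le> (l - 1)\<^sup>2" using that(1) by (intro power_mono) auto
    then have le: "(2::int) ^ (k\<^sup>2) \<le> 2 ^ ((l - 1)\<^sup>2)" by (intro power_increasing) auto
    have "\<bar>y $ r\<bar> \<le> int (2 ^ ((l - 1)\<^sup>2) + 1)" for r
    proof -
      have "\<bar>x $ r\<bar> \<le> 2 ^ (k\<^sup>2)" "\<bar>y $ r - x $ r\<bar> \<le> 1"
        using that(2) y by (auto simp: ring_def cube_def)
      then have "\<bar>y $ r\<bar> \<le> 2 ^ (k\<^sup>2) + 1" by linarith
      also have "\<dots> \<le> 2 ^ ((l - 1)\<^sup>2) + 1" using le by (rule add_right_mono)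
      finally show ?thesis by simp
    qed
    then have "y \<in> inner l" by (simp add: inner_def cube_def)
    then show False using that(3) by (simp add: ring_def)
  qed
  have eq: "{\<omega> \<in> space M. \<omega> \<notin> escapes (a k) (ring k)} =
      {\<omega> \<in> space M. \<not> (\<forall>x\<in>ring k. \<not> star x \<subseteq> {e \<in> \<Union> (star ` ring k). W e \<omega> \<le> a k})}" for k
    unfolding escapes_as_closed_set by blast
  have "prob {\<omega> \<in> space M. \<forall>k\<in>J. \<not> (\<forall>x\<in>ring k. \<not> star x \<subseteq> {e \<in> \<Union> (star ` ring k). W e \<omega> \<le> a k})} =
      (\<Prod>k\<in>J. prob {\<omega> \<in> space M. \<not> (\<forall>x\<in>ring k. \<not> star x \<subseteq> {e \<in> \<Union> (star ` ring k). W e \<omega> \<le> a k})})"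
  proof (rule indep_closed_sets[where K = "\<lambda>k. \<Union> (star ` ring k)", OF assms])
    show "finite (\<Union> (star ` ring k))" for k by (auto simp: ring_def card_cube)
    show "disjoint_family_on (\<lambda>k. \<Union> (star ` ring k)) J"
      unfolding disjoint_family_on_def
    proof (intro ballI impI)
      fix k l :: nat assume "k \<noteq> l"
      then consider "k < l" | "l < k" by linarith
      then show "\<Union> (star ` ring k) \<inter> \<Union> (star ` ring l) = {}" by cases (use disj in fast)+
    qed
  qed
  moreover have "{\<omega> \<in> space M. \<forall>k\<in>J. \<omega> \<notin> escapes (a k) (ring k)} =
      {\<omega> \<in> space M. \<forall>k\<in>J. \<not> (\<forall>x\<in>ring k. \<not> star x \<subseteq> {e \<in> \<Union> (star ` ring k). W e \<omega> \<le> a k})}"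
    unfolding escapes_as_closed_set by blast
  ultimately show ?thesis unfolding eq by simp
qed

definition \<kappa> :: nat where "\<kappa> = (2 * (2 * m + 2 * CARD('n) + 1) + 1) ^ CARD('n)"

text \<open>The two terms of \<open>spectral_bound\<close> are balanced: the choice of
  \<open>q\<close> makes the local term, and that of \<open>\<eta>\<close> the row term, at most
  \<open>1 / (2 * C * G N)\<close>.\<close>

lemma good_environment:
  assumes C: "C > 0" and q: "36 * real m * real \<kappa> * C \<le> 4 ^ q" and \<eta>: "\<eta> = 1 / (72 * real m * real \<kappa> * C)"
    and j: "8 * j \<le> N" and N: "2 * CARD('n) + 1 \<le> 2 ^ N" and mean: "4 ^ N * G N * mean j N \<le> \<eta> / 8"
    and \<omega>: "\<omega> \<in> space M" "\<omega> \<notin> crowded q N" "\<omega> \<notin> blocked N" "\<omega> \<notin> resistive \<eta> j N"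
      "\<omega> \<in> escapes (4 ^ q * G N) (cube (2 ^ N) 0)"
    and f: "\<And>x. x \<notin> cube (2 ^ N) 0 \<Longrightarrow> f x = (0::real)"
  shows "\<exists>S. finite S \<and> C * G N * (\<Sum>x\<in>cube (2 ^ N) 0. (f x)\<^sup>2) \<le> (\<Sum>e\<in>S. edge_energy (\<lambda>e. W e \<omega>) f e)"
proof -
  define n :: nat where "n = 2 ^ N"
  define a where "a = 4 ^ q * G N"
  define \<epsilon> where "\<epsilon> = \<eta> / (8 * 4 ^ N * G N)"
  define R where "R = (real n + 1) * mean j N + 2 * \<epsilon> * real n"
  define T where "T c = resist G j (N div 8) m (rect m i i' c) (\<lambda>e. W e \<omega>)" for c
  have G0: "G N > 0" by (rule G_pos)
  have mk: "m > 0" "\<kappa> > 0" by (simp_all add: m_def \<kappa>_def)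
  have "\<exists>S. finite S \<and> (\<Sum>x\<in>cube n 0. (f x)\<^sup>2) \<le>
     (18 * real m * real \<kappa> / a + 36 * real m * real \<kappa> * R * (real n + 1)) * (\<Sum>e\<in>S. edge_energy (\<lambda>e. W e \<omega>) f e)"
    unfolding \<kappa>_def
  proof (rule spectral_bound[OF dim axes, where T = T])
    show "0 \<le> W e \<omega>" for e using W_pos[OF \<omega>(1)] by (rule less_imp_le)
    show "a > 0" using G0 by (simp add: a_def)
    show "2 * CARD('n) \<le> m" by (simp add: m_def)
    show "2 * CARD('n) + 1 \<le> n" using N by (simp add: n_def)
    show "f x = 0" if "x \<notin> cube n 0" for x using f that by (simp add: n_def)
    show "\<exists>e\<in>star x. a < W e \<omega>" if "x \<in> cube n 0" for x
      using \<omega>(5) that by (auto simp: escapes_def a_def n_def)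
    show "card {e \<in> cube (m + 2 * CARD('n) + 1) x \<times> UNIV. W e \<omega> \<le> a} \<le> 2 * CARD('n)" if "x \<in> cube n 0" for x
      using \<omega>(1,2) that unfolding crowded_def Q_def a_def n_def by (auto simp: not_le)
    show "\<exists>s>0. card {e \<in> rect m i i' (z + axis i (int (k * m))). W e \<omega> \<le> s} < m \<and> 1 / s \<le> T (z + axis i (int (k * m)))"
      if "z \<in> cube (2 * n) 0" "k \<le> n" for z k
      unfolding T_def
    proof (rule resist_level[OF G_pos])
      show "j \<le> N div 8" using j by simp
      show "card {e \<in> rect m i i' (z + axis i (int (k * m))). W e \<omega> \<le> G (N div 8)} < m"
        using \<omega>(1,3) that unfolding blocked_def corner_def n_def by (auto simp: not_le)
    qed
    show "(\<Sum>k\<le>n. T (z + axis i (int (k * m)))) \<le> R" if "z \<in> cube (2 * n) 0" for z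
      using \<omega>(1,4) that unfolding resistive_def corner_def n_def T_def R_def \<epsilon>_def by (auto simp: not_le less_imp_le)
  qed
  then obtain S where S: "finite S" and b: "(\<Sum>x\<in>cube n 0. (f x)\<^sup>2) \<le>
     (18 * real m * real \<kappa> / a + 36 * real m * real \<kappa> * R * (real n + 1)) * (\<Sum>e\<in>S. edge_energy (\<lambda>e. W e \<omega>) f e)"
    by blast
  have E0: "(\<Sum>e\<in>S. edge_energy (\<lambda>e. W e \<omega>) f e) \<ge> 0"
    using W_pos[OF \<omega>(1)] by (intro sum_nonneg) (auto simp: edge_energy_def less_imp_le)
  have n1: "real n \<ge> 1" "real n + 1 \<le> 2 * real n" by (simp_all add: n_def)
  have n2: "(real n)\<^sup>2 = 4 ^ N" by (simp add: n_def power2_eq_square flip: power_mult_distrib)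
  have mean0: "mean j N \<ge> 0" unfolding mean_def using G_pos F_nonneg
    by (intro add_nonneg_nonneg sum_nonneg) (auto simp: less_imp_le)
  have \<epsilon>0: "\<epsilon> \<ge> 0" using C mk G0 by (simp add: \<epsilon>_def \<eta> mult.assoc)
  \<comment> \<open>By \<open>real n + 1 \<le> 2 * real n\<close> the mean and the deviation each
    enter with a factor 4, which turns their bounds \<open>\<eta> / 8\<close> into
    \<open>\<eta> / 2\<close>.\<close>
  have "R * (real n + 1) \<le> (2 * real n * mean j N + 2 * \<epsilon> * real n) * (2 * real n)"
    unfolding R_def using n1 mean0 \<epsilon>0 by (intro mult_mono add_mono mult_right_mono) auto
  also have "\<dots> = 4 * (4 ^ N * mean j N) + 4 * (4 ^ N * \<epsilon>)"
    unfolding n2[symmetric] by (simp add: power2_eq_square algebra_simps)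
  finally have "G N * (R * (real n + 1)) \<le> G N * (4 * (4 ^ N * mean j N) + 4 * (4 ^ N * \<epsilon>))"
    using G0 by (intro mult_left_mono) auto
  also have "\<dots> = 4 * (4 ^ N * G N * mean j N) + 4 * (4 ^ N * G N * \<epsilon>)" by (simp add: algebra_simps)
  also have "4 ^ N * G N * \<epsilon> = \<eta> / 8" using G0 by (simp add: \<epsilon>_def)
  also have "4 * (4 ^ N * G N * mean j N) + 4 * (\<eta> / 8) \<le> \<eta>" using mean by simp
  finally have RG: "G N * (R * (real n + 1)) \<le> \<eta>" .
  have 1: "C * G N * (18 * real m * real \<kappa> / a) \<le> 1 / 2"
  proof -
    have "C * G N * (18 * real m * real \<kappa> / a) = (36 * real m * real \<kappa> * C / 4 ^ q) / 2"
      using G0 by (simp add: a_def)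
    also have "\<dots> \<le> 1 / 2" using q by (intro divide_right_mono) auto
    finally show ?thesis .
  qed
  have 2: "C * G N * (36 * real m * real \<kappa> * R * (real n + 1)) \<le> 1 / 2"
  proof -
    have "C * G N * (36 * real m * real \<kappa> * R * (real n + 1)) = 36 * real m * real \<kappa> * C * (G N * (R * (real n + 1)))"
      by simp
    also have "\<dots> \<le> 36 * real m * real \<kappa> * C * \<eta>" using RG mk C by (intro mult_left_mono) (auto simp: mult.assoc)
    also have "\<dots> = 1 / 2" using mk C by (simp add: \<eta>)
    finally show ?thesis .
  qed
  have "C * G N * (\<Sum>x\<in>cube n 0. (f x)\<^sup>2) \<le> C * G N *
     ((18 * real m * real \<kappa> / a + 36 * real m * real \<kappa> * R * (real n + 1)) * (\<Sum>e\<in>S. edge_energy (\<lambda>e. W e \<omega>) f e))"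
    using b C G0 by (intro mult_left_mono) auto
  also have "\<dots> = (C * G N * (18 * real m * real \<kappa> / a) + C * G N * (36 * real m * real \<kappa> * R * (real n + 1))) *
      (\<Sum>e\<in>S. edge_energy (\<lambda>e. W e \<omega>) f e)"
    by (simp only: distrib_left distrib_right mult.assoc)
  also have "\<dots> \<le> 1 * (\<Sum>e\<in>S. edge_energy (\<lambda>e. W e \<omega>) f e)"
    using 1 2 E0 by (intro mult_right_mono) auto
  finally show ?thesis using S unfolding n_def by auto
qed

text \<open>Only the ring events have to be independent: the bad events are summable and almost
  surely cease, so any late index with a trap-free ring serves.\<close>

theorem energy_large_infinitely_often:
  assumes C: "C > 0"
  shows "AE \<omega> in M. \<forall>K. \<exists>N\<ge>K. \<forall>f. (\<forall>x. x \<notin> cube (2 ^ N) 0 \<longrightarrow> f x = (0::real)) \<longrightarrow>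
    (\<exists>S. finite S \<and> C * G N * (\<Sum>x\<in>cube (2 ^ N) 0. (f x)\<^sup>2) \<le> (\<Sum>e\<in>S. edge_energy (\<lambda>e. W e \<omega>) f e))"
proof -
  define \<eta> where "\<eta> = 1 / (72 * real m * real \<kappa> * C)"
  have mk: "real m > 0" "real \<kappa> > 0" by (simp_all add: m_def \<kappa>_def)
  have \<eta>: "\<eta> > 0" using mk C by (simp add: \<eta>_def)
  obtain q where q: "36 * real m * real \<kappa> * C \<le> 4 ^ q"
    using real_arch_pow[of 4 "36 * real m * real \<kappa> * C"] less_imp_le by (metis one_less_numeral_iff semiring_norm(76))
  obtain j where j: "L \<le> j" and mean: "eventually (\<lambda>N. 4 ^ N * G N * mean j N \<le> \<eta> / 8) sequentially"
    using mean_small[OF \<eta>] by blast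
  from crowded_bound obtain c1 where c1: "eventually (\<lambda>N. prob (crowded q N) \<le> c1 / real N) sequentially" ..
  from blocked_bound obtain c2 where c2: "eventually (\<lambda>N. prob (blocked N) \<le> c2 / real N) sequentially" ..
  from resistive_bound[OF \<eta> j] obtain c3 where
    c3: "eventually (\<lambda>N. prob (resistive \<eta> j N) \<le> c3 / real N) sequentially" ..
  from inner_trap_bound obtain c4 where
    c4: "eventually (\<lambda>k. prob (inner_trap q k) \<le> c4 / (real k)\<^sup>2) sequentially" ..
  define bad where "bad k = crowded q (k\<^sup>2) \<union> blocked (k\<^sup>2) \<union> (resistive \<eta> j (k\<^sup>2) \<union> inner_trap q k)" for k
  have bad_event: "bad k \<in> events" for k
    unfolding bad_def by (intro sets.Un crowded_event blocked_event resistive_event inner_trap_event)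
  have "eventually (\<lambda>k. prob (bad k) \<le> (c1 + c2 + c3 + c4) * inverse ((real k)\<^sup>2)) sequentially"
    using eventually_compose_filterlim[OF c1 filterlim_square] eventually_compose_filterlim[OF c2 filterlim_square]
      eventually_compose_filterlim[OF c3 filterlim_square] c4
  proof eventually_elim
    case (elim k)
    have "prob (bad k) \<le> prob (crowded q (k\<^sup>2) \<union> blocked (k\<^sup>2)) + prob (resistive \<eta> j (k\<^sup>2) \<union> inner_trap q k)"
      unfolding bad_def by (intro measure_Un_le sets.Un crowded_event blocked_event resistive_event inner_trap_event)
    also have "\<dots> \<le> (prob (crowded q (k\<^sup>2)) + prob (blocked (k\<^sup>2))) + (prob (resistive \<eta> j (k\<^sup>2)) + prob (inner_trap q k))"
      by (intro add_mono measure_Un_le crowded_event blocked_event resistive_event inner_trap_event)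
    also have "\<dots> \<le> (c1 / real (k\<^sup>2) + c2 / real (k\<^sup>2)) + (c3 / real (k\<^sup>2) + c4 / (real k)\<^sup>2)"
      using elim by (intro add_mono)
    also have "\<dots> = (c1 + c2 + c3 + c4) * inverse ((real k)\<^sup>2)" by (simp add: field_simps add_divide_distrib)
    finally show ?case .
  qed
  then have "eventually (\<lambda>k. norm (prob (bad k)) \<le> (c1 + c2 + c3 + c4) * inverse ((real k)\<^sup>2)) sequentially"
    by simp
  moreover have "summable (\<lambda>k. (c1 + c2 + c3 + c4) * inverse ((real k)\<^sup>2))"
    by (intro summable_mult inverse_power_summable) simp
  ultimately have "summable (\<lambda>k. prob (bad k))" by (rule summable_comparison_test_ev)
  then have AE1: "AE \<omega> in M. eventually (\<lambda>k. \<omega> \<in> space M - bad k) sequentially"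
    using bad_event by (intro borel_cantelli_AE1) (auto simp: emeasure_eq_measure)
  define A where "A k = escapes (4 ^ q * G (k\<^sup>2)) (ring k)" for k
  have AE2: "AE \<omega> in M. \<forall>K. \<exists>k\<ge>K. \<omega> \<in> A k"
  proof (rule borel_cantelli2)
    show "A k \<in> events" for k unfolding A_def by (rule escapes_event) (simp add: ring_def card_cube)
    show "prob {\<omega> \<in> space M. \<forall>k\<in>J. \<omega> \<notin> A k} = (\<Prod>k\<in>J. prob {\<omega> \<in> space M. \<omega> \<notin> A k})" if "finite J" for J
      unfolding A_def using that by (rule rings_indep)
    have "eventually (\<lambda>k. inverse (real k) \<le> prob (A k)) sequentially"
      using eventually_compose_filterlim[OF escapes_lower_bound[of q] filterlim_square] eventually_ge_at_top[of 1]
    proof eventually_elim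
      case (elim k)
      have "inverse (real k) = exp (- ln (real (k\<^sup>2)) / 2)"
        using elim(2) by (simp add: ln_realpow exp_minus)
      also have "\<dots> \<le> prob (A k)" using elim(1) by (simp add: A_def ring_def)
      finally show ?case .
    qed
    then have "eventually (\<lambda>k. norm (inverse (real k)) \<le> prob (A k)) sequentially" by simp
    then have "summable (\<lambda>k. inverse (real k))" if "summable (\<lambda>k. prob (A k))"
      using that by (rule summable_comparison_test_ev)
    then show "\<not> summable (\<lambda>k. prob (A k))" using not_summable_harmonic[where 'a = real] by fast
  qed
  have "eventually (\<lambda>N. 8 * j \<le> N \<and> 2 * CARD('n) + 1 \<le> (2::nat) ^ N \<and> 4 ^ N * G N * mean j N \<le> \<eta> / 8) sequentially"
    using mean eventually_ge_at_top[of "8 * j + 2 * CARD('n) + 1"]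
  proof eventually_elim
    case (elim N)
    have "N < 2 ^ N" by (rule less_exp)
    with elim show ?case by linarith
  qed
  then have fine: "eventually (\<lambda>k. 8 * j \<le> k\<^sup>2 \<and> 2 * CARD('n) + 1 \<le> (2::nat) ^ (k\<^sup>2) \<and>
      4 ^ (k\<^sup>2) * G (k\<^sup>2) * mean j (k\<^sup>2) \<le> \<eta> / 8) sequentially"
    by (rule eventually_compose_filterlim[OF _ filterlim_square])
  show ?thesis using AE1 AE2
  proof eventually_elim
    case (elim \<omega>)
    show ?case
    proof
      fix K
      obtain k0 where k0: "\<And>k. k \<ge> k0 \<Longrightarrow> \<omega> \<in> space M - bad k \<and> 8 * j \<le> k\<^sup>2 \<and> 2 * CARD('n) + 1 \<le> (2::nat) ^ (k\<^sup>2) \<and>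
          4 ^ (k\<^sup>2) * G (k\<^sup>2) * mean j (k\<^sup>2) \<le> \<eta> / 8"
        using eventually_conj[OF elim(1) fine] unfolding eventually_sequentially by blast
      obtain k where k: "k \<ge> max k0 K" "\<omega> \<in> A k" using elim(2) by blast
      have kk: "K \<le> k\<^sup>2" using k(1) by (metis le_square max.bounded_iff order_trans power2_eq_square)
      have \<omega>: "\<omega> \<in> space M" "\<omega> \<notin> crowded q (k\<^sup>2)" "\<omega> \<notin> blocked (k\<^sup>2)" "\<omega> \<notin> resistive \<eta> j (k\<^sup>2)" "\<omega> \<notin> inner_trap q k"
        using k0[of k] k(1) by (auto simp: bad_def)
      have esc: "\<omega> \<in> escapes (4 ^ q * G (k\<^sup>2)) (cube (2 ^ (k\<^sup>2)) 0)"
        unfolding escapes_def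
      proof (rule CollectI, intro conjI ballI)
        fix x :: "int ^ 'n" assume x: "x \<in> cube (2 ^ (k\<^sup>2)) 0"
        show "\<exists>e\<in>star x. 4 ^ q * G (k\<^sup>2) < W e \<omega>"
        proof (cases "x \<in> inner k")
          case True
          then show ?thesis using \<omega>(1,5) by (auto simp: inner_trap_def not_le)
        next
          case False
          then show ?thesis using k(2) x by (auto simp: A_def escapes_def ring_def)
        qed
      qed (rule \<omega>(1))
      have good: "\<exists>S. finite S \<and> C * G (k\<^sup>2) * (\<Sum>x\<in>cube (2 ^ (k\<^sup>2)) 0. (f x)\<^sup>2) \<le> (\<Sum>e\<in>S. edge_energy (\<lambda>e. W e \<omega>) f e)"
        if "\<forall>x. x \<notin> cube (2 ^ (k\<^sup>2)) 0 \<longrightarrow> f x = 0" for f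
        by (rule good_environment[OF C q \<eta>_def _ _ _ \<omega>(1-4) esc]) (use k0[of k] k(1) that in auto)
      show "\<exists>N\<ge>K. \<forall>f. (\<forall>x. x \<notin> cube (2 ^ N) 0 \<longrightarrow> f x = 0) \<longrightarrow>
        (\<exists>S. finite S \<and> C * G N * (\<Sum>x\<in>cube (2 ^ N) 0. (f x)\<^sup>2) \<le> (\<Sum>e\<in>S. edge_energy (\<lambda>e. W e \<omega>) f e))"
        using kk good by blast
    qed
  qed
qed

end

section \<open>The principal eigenvalue\<close>

lemma (in prob_space) indep_vars_reindex:
  assumes "inj h" "indep_vars (\<lambda>_. N) X (range h)"
  shows "indep_vars (\<lambda>_. N) (\<lambda>j. X (h j)) UNIV"
proof -
  have 1: "indep_vars (\<lambda>j. PiM {h j} (\<lambda>_. N)) (\<lambda>j \<omega>. restrict (\<lambda>e. X e \<omega>) {h j}) UNIV"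
    using assms by (intro indep_vars_restrict[where I = "range h"]) (auto simp: disjoint_family_on_def inj_def)
  show ?thesis
    using indep_vars_compose2[OF 1, of "\<lambda>j f. f (h j)" "\<lambda>_. N"]
    by (simp add: measurable_component_singleton)
qed

section \<open>From pairs of a site and a direction to lattice edges\<close>

lemma lattice_adj_step: "lattice_adj v (v + axis k 1)"
proof -
  have "(\<Sum>j\<in>UNIV. \<bar>v $ j - (v + axis k 1) $ j\<bar>) = (\<Sum>j\<in>UNIV. if j = k then 1 else 0)"
    by (intro sum.cong) (auto simp: axis_nth_if)
  then show ?thesis by (simp add: lattice_adj_def l1dist_def)
qed

lemma lattice_adj_cube: "lattice_adj x y \<Longrightarrow> y \<in> cube 1 x"
proof -
  assume a: "lattice_adj x y"
  have "\<bar>x $ k - y $ k\<bar> \<le> 1" for k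
  proof -
    have "\<bar>x $ k - y $ k\<bar> \<le> (\<Sum>j\<in>UNIV. \<bar>x $ j - y $ j\<bar>)" by (rule member_le_sum) auto
    then show ?thesis using a by (simp add: lattice_adj_def l1dist_def)
  qed
  then show ?thesis by (simp add: cube_def abs_minus_commute)
qed

text \<open>Two different base points of one edge would force two positive unit vectors to add up to
  zero. Injectivity lets the weights indexed by pairs inherit independence.\<close>

lemma inj_edge: "inj (\<lambda>(v, k). {v, v + axis k (1::int)})"
proof (rule injI, clarify)
  fix v k v' k' assume e: "{v, v + axis k (1::int)} = {v', v' + axis k' 1}"
  show "v = v' \<and> k = k'"
  proof (cases "v = v'")
    case True
    then have "axis k (1::int) = axis k' 1" using e by (auto simp: doubleton_eq_iff)
    then show ?thesis using True by (simp add: axis_eq_axis)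
  next
    case False
    then have "v = v' + axis k' 1" "v + axis k 1 = v'" using e by (auto simp: doubleton_eq_iff)
    then have "axis k' 1 + axis k 1 = (0 :: int ^ _)" by (simp add: add.assoc)
    then have "(axis k' 1 + axis k 1) $ k = (0 :: int ^ _) $ k" by (rule arg_cong)
    then show ?thesis by (simp add: axis_nth_if split: if_splits)
  qed
qed

text \<open>The sum over ordered pairs counts every edge twice, but only neighbours in positive
  directions are kept. The resulting factor 2 is absorbed by the arbitrary constant in front of
  \<open>g\<close>.\<close>

lemma edge_energy_le_dirichlet_form:
  fixes f :: "int ^ 'n \<Rightarrow> real"
  assumes wt: "\<And>e. e \<in> lattice_edges \<Longrightarrow> wt e \<ge> 0" and supp: "\<And>x. x \<notin> cube n 0 \<Longrightarrow> f x = 0"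
    and S: "finite S"
  shows "(\<Sum>e\<in>S. edge_energy (\<lambda>(v, k). wt {v, v + axis k 1}) f e) \<le> 2 * dirichlet_form wt f"
proof -
  define h where "h x = (\<Sum>y\<in>{y. lattice_adj x y}. wt {x, y} * (f x - f y)\<^sup>2)" for x
  define F where "F = edge_energy (\<lambda>(v, k). wt {v, v + axis k 1}) f"
  \<comment> \<open>The extra layer is needed because \<open>h\<close> can be nonzero at sites
    adjacent to the support of \<open>f\<close>.\<close>
  define X where "X = cube (n + 1) 0 \<union> fst ` S"
  have finX: "finite X" using S by (simp add: X_def card_cube)
  have wt': "wt {x, y} \<ge> 0" if "lattice_adj x y" for x y
    using that by (intro wt) (auto simp: lattice_edges_def)
  have fin: "finite {y. lattice_adj x y}" for x :: "int ^ 'n"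
    by (rule finite_subset[OF _ card_cube(1)[of 1 x]]) (auto dest: lattice_adj_cube)
  have h0: "h x = 0" if "x \<notin> X" for x
  proof -
    have "f y = 0" if y: "y \<in> cube 1 x" for y
    proof (rule supp, rule notI)
      assume "y \<in> cube n 0"
      then have b: "\<bar>y $ k\<bar> \<le> int n" "\<bar>y $ k - x $ k\<bar> \<le> 1" for k using y by (auto simp: cube_def)
      have "\<bar>x $ k\<bar> \<le> int n + 1" for k using b[of k] by linarith
      then have "x \<in> X" by (simp add: X_def cube_def add.commute)
      then show False using \<open>x \<notin> X\<close> by simp
    qed
    moreover have "x \<in> cube 1 x" by (simp add: cube_def)
    ultimately show ?thesis unfolding h_def by (intro sum.neutral) (auto dest: lattice_adj_cube)
  qed
  have F0: "F e \<ge> 0" for e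
    using wt'[OF lattice_adj_step, of "fst e" "snd e"] by (simp add: F_def edge_energy_def split_def)
  have "S \<subseteq> X \<times> UNIV" by (force simp: X_def)
  then have "(\<Sum>e\<in>S. F e) \<le> (\<Sum>e\<in>X \<times> UNIV. F e)"
    using finX F0 by (intro sum_mono2) auto
  also have "\<dots> = (\<Sum>x\<in>X. \<Sum>k\<in>UNIV. F (x, k))" by (simp add: sum.cartesian_product)
  also have "\<dots> \<le> (\<Sum>x\<in>X. h x)"
  proof (rule sum_mono)
    fix x
    have "(\<Sum>k\<in>UNIV. F (x, k)) = (\<Sum>y\<in>range (\<lambda>k. x + axis k 1). wt {x, y} * (f x - f y)\<^sup>2)"
      by (subst sum.reindex) (auto simp: inj_def axis_eq_axis F_def edge_energy_def)
    also have "\<dots> \<le> h x"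
      unfolding h_def using fin wt' by (intro sum_mono2) (auto simp: lattice_adj_step)
    finally show "(\<Sum>k\<in>UNIV. F (x, k)) \<le> h x" .
  qed
  also have "\<dots> = infsum h X" using finX by simp
  also have "\<dots> = infsum h UNIV" by (rule infsum_cong_neutral) (use h0 in auto)
  also have "\<dots> = 2 * dirichlet_form wt f" by (simp add: dirichlet_form_def h_def[abs_def])
  finally show ?thesis by (simp add: F_def)
qed

lemma principal_eigenvalue_ge:
  fixes wt :: "(int ^ 'n) set \<Rightarrow> real"
  assumes wt: "\<And>e. e \<in> lattice_edges \<Longrightarrow> wt e \<ge> 0"
    and b: "\<And>f :: int ^ 'n \<Rightarrow> real. (\<forall>x. x \<notin> cube n 0 \<longrightarrow> f x = 0) \<Longrightarrow>
      \<exists>S. finite S \<and> b * (\<Sum>x\<in>cube n 0. (f x)\<^sup>2) \<le> (\<Sum>e\<in>S. edge_energy (\<lambda>(v, k). wt {v, v + axis k 1}) f e)"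
  shows "principal_eigenvalue wt n \<ge> b / 2"
  unfolding principal_eigenvalue_def
proof (rule cInf_greatest)
  have sq: "(\<Sum>\<^sub>\<infinity>x. (f x)\<^sup>2) = (\<Sum>x\<in>cube n 0. (f x)\<^sup>2)" if "\<forall>x. x \<notin> cube n 0 \<longrightarrow> f x = 0" for f :: "int ^ 'n \<Rightarrow> real"
  proof -
    have "(\<Sum>\<^sub>\<infinity>x. (f x)\<^sup>2) = infsum (\<lambda>x. (f x)\<^sup>2) (cube n 0)" by (rule infsum_cong_neutral) (use that in auto)
    then show ?thesis by (simp add: card_cube)
  qed
  \<comment> \<open>A test function of norm one: the infimum of reals can be bounded below only over
    a nonempty set.\<close>
  define \<delta> :: "int ^ 'n \<Rightarrow> real" where "\<delta> = (\<lambda>x. if x = 0 then 1 else 0)"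
  have z: "(0 :: int ^ 'n) \<in> cube n 0" by (simp add: cube_def)
  have "(\<Sum>x\<in>cube n 0. (\<delta> x)\<^sup>2) = (\<Sum>x\<in>cube n (0 :: int ^ 'n). if x = 0 then 1 else 0)" by (intro sum.cong) (auto simp: \<delta>_def)
  also have "\<dots> = 1" using z by (simp add: card_cube)
  finally have "(\<Sum>\<^sub>\<infinity>x. (\<delta> x)\<^sup>2) = 1" using z by (subst sq) (auto simp: \<delta>_def)
  moreover have "{x. \<delta> x \<noteq> 0} \<subseteq> Defs.box n" using z by (auto simp: \<delta>_def box_eq_cube)
  ultimately show "{dirichlet_form wt f | f. {x. f x \<noteq> 0} \<subseteq> Defs.box n \<and> (\<Sum>\<^sub>\<infinity>x. (f x)\<^sup>2) = 1} \<noteq> {}" by blast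
  fix y assume "y \<in> {dirichlet_form wt f | f. {x. f x \<noteq> 0} \<subseteq> Defs.box n \<and> (\<Sum>\<^sub>\<infinity>x. (f x)\<^sup>2) = 1}"
  then obtain f where y: "y = dirichlet_form wt f" and f: "{x. f x \<noteq> 0} \<subseteq> cube n 0" "(\<Sum>\<^sub>\<infinity>x. (f x)\<^sup>2) = 1"
    by (auto simp: box_eq_cube)
  have f0: "\<forall>x. x \<notin> cube n 0 \<longrightarrow> f x = 0" using f(1) by auto
  obtain S where S: "finite S" "b * (\<Sum>x\<in>cube n 0. (f x)\<^sup>2) \<le> (\<Sum>e\<in>S. edge_energy (\<lambda>(v, k). wt {v, v + axis k 1}) f e)"
    using b[OF f0] by blast
  have "b \<le> (\<Sum>e\<in>S. edge_energy (\<lambda>(v, k). wt {v, v + axis k 1}) f e)" using S(2) f(2) sq[OF f0] by simp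
  also have "\<dots> \<le> 2 * dirichlet_form wt f"
    by (rule edge_energy_le_dirichlet_form[OF wt _ S(1)]) (use f0 in auto)
  finally show "b / 2 \<le> y" by (simp add: y)
qed

section \<open>The hypotheses on \<open>g\<close> at dyadic scales\<close>

lemma tendsto_zero_if_ratio:
  fixes x :: "nat \<Rightarrow> real"
  assumes "\<And>l. x l \<ge> 0" "r < 1" "eventually (\<lambda>l. x (Suc l) \<le> r * x l) sequentially"
  shows "x \<longlonglongrightarrow> 0"
proof -
  obtain K where "\<And>l. l \<ge> K \<Longrightarrow> x (Suc l) \<le> r * x l" using assms(3) by (auto simp: eventually_sequentially)
  then have "summable x" using assms(1,2) by (intro summable_ratio_test[of r K]) auto
  then show ?thesis by (rule summable_LIMSEQ_zero)
qed

lemma filterlim_power2_at_top: "filterlim (\<lambda>l. (2::real) ^ l) at_top sequentially"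
  by real_asymp

text \<open>In the regularly varying case \<open>g (2 * u) / g u\<close> tends to
  \<open>2 powr \<rho>\<close>, which is below 1/4; a fixed ratio \<open>r\<close> below 1/4
  therefore works for large \<open>u\<close>, and \<open>4 ^ l * g (2 ^ l)\<close> decays
  geometrically. In the other case monotonicity and limit of u^2 g(u) are read off at powers of
  two.\<close>

lemma dyadic_decay:
  fixes g :: "real \<Rightarrow> real"
  assumes g_pos: "\<forall>u>0. g u > 0"
    and cases: "(\<exists>rho < -2. regularly_varying g rho) \<or>
                ((\<exists>U. \<forall>u v. U \<le> u \<longrightarrow> u \<le> v \<longrightarrow> v^2 * g v \<le> u^2 * g u)
                  \<and> ((\<lambda>u. u^2 * g u) \<longlongrightarrow> 0) at_top)"
  shows "eventually (\<lambda>l. 4 * g (2 ^ Suc l) \<le> g (2 ^ l)) sequentially \<and> (\<lambda>l. 4 ^ l * g (2 ^ l)) \<longlonglongrightarrow> 0"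
  using cases
proof
  assume "\<exists>rho < -2. regularly_varying g rho"
  then obtain \<rho> \<Lambda> where \<rho>: "\<rho> < -2" and g: "\<forall>u>0. g u = u powr \<rho> * \<Lambda> u"
    and "\<forall>C>0. ((\<lambda>u. \<Lambda> (C * u) / \<Lambda> u) \<longlongrightarrow> 1) at_top"
    unfolding regularly_varying_def by (elim exE conjE)
  then have \<Lambda>: "((\<lambda>u. \<Lambda> (2 * u) / \<Lambda> u) \<longlongrightarrow> 1) at_top" by simp
  have "(2::real) powr \<rho> < 2 powr (-2)" using \<rho> by (intro powr_less_mono) auto
  also have "(2::real) powr (-2) = 1 / 4" by (simp add: powr_minus powr_numeral)
  finally obtain r where r: "2 powr \<rho> < r" "r < 1 / 4" using dense by blast
  have "((\<lambda>u. 2 powr \<rho> * (\<Lambda> (2 * u) / \<Lambda> u)) \<longlongrightarrow> 2 powr \<rho> * 1) at_top" by (intro tendsto_intros \<Lambda>)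
  then have "eventually (\<lambda>u. 2 powr \<rho> * (\<Lambda> (2 * u) / \<Lambda> u) < r) at_top" by (rule order_tendstoD) (use r in simp)
  then have "eventually (\<lambda>u. g (2 * u) \<le> r * g u) at_top"
    using eventually_gt_at_top[of 0]
  proof eventually_elim
    case (elim u)
    have "g u > 0" using g_pos elim by simp
    moreover have "g (2 * u) / g u = 2 powr \<rho> * (\<Lambda> (2 * u) / \<Lambda> u)" using elim(2) by (simp add: g powr_mult)
    ultimately show ?case using elim(1) by (metis less_imp_le pos_divide_less_eq)
  qed
  then have ev: "eventually (\<lambda>l. g (2 * 2 ^ l) \<le> r * g (2 ^ l)) sequentially"
    by (rule eventually_compose_filterlim[OF _ filterlim_power2_at_top])
  have gp: "g (2 ^ l) > 0" for l using g_pos by simp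
  have "eventually (\<lambda>l. 4 * g (2 ^ Suc l) \<le> g (2 ^ l)) sequentially"
    using ev
  proof eventually_elim
    case (elim l)
    have "r * g (2 ^ l) \<le> 1 / 4 * g (2 ^ l)" using r gp[of l] by (intro mult_right_mono) auto
    then show ?case using elim by simp
  qed
  moreover have "(\<lambda>l. 4 ^ l * g (2 ^ l)) \<longlonglongrightarrow> 0"
  proof (rule tendsto_zero_if_ratio[where r = "4 * r"])
    show "4 ^ l * g (2 ^ l) \<ge> 0" for l using gp[of l] by simp
    show "eventually (\<lambda>l. 4 ^ Suc l * g (2 ^ Suc l) \<le> 4 * r * (4 ^ l * g (2 ^ l))) sequentially"
      using ev
    proof eventually_elim
      case (elim l)
      have "4 * 4 ^ l * g (2 * 2 ^ l) \<le> 4 * 4 ^ l * (r * g (2 ^ l))" using elim by (intro mult_left_mono) auto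
      then show ?case by (simp add: mult_ac)
    qed
  qed (use r in simp)
  ultimately show ?thesis ..
next
  assume b: "(\<exists>U. \<forall>u v. U \<le> u \<longrightarrow> u \<le> v \<longrightarrow> v^2 * g v \<le> u^2 * g u) \<and> ((\<lambda>u. u^2 * g u) \<longlongrightarrow> 0) at_top"
  then obtain U where U: "\<And>u v. U \<le> u \<Longrightarrow> u \<le> v \<Longrightarrow> v^2 * g v \<le> u^2 * g u" by blast
  have "eventually (\<lambda>u. 4 * g (2 * u) \<le> g u) at_top"
    using eventually_ge_at_top[of U] eventually_gt_at_top[of 0]
  proof eventually_elim
    case (elim u)
    have "(2 * u)\<^sup>2 * g (2 * u) \<le> u\<^sup>2 * g u" using elim by (intro U) auto
    then have "u\<^sup>2 * (4 * g (2 * u)) \<le> u\<^sup>2 * g u" by (simp add: power_mult_distrib mult_ac)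
    then show ?case using elim by simp
  qed
  then have "eventually (\<lambda>l. 4 * g (2 * 2 ^ l) \<le> g (2 ^ l)) sequentially"
    by (rule eventually_compose_filterlim[OF _ filterlim_power2_at_top])
  moreover have "(\<lambda>l. (2 ^ l)\<^sup>2 * g (2 ^ l)) \<longlonglongrightarrow> 0"
    by (rule filterlim_compose[OF conjunct2[OF b] filterlim_power2_at_top])
  moreover have "((2::real) ^ l)\<^sup>2 = 4 ^ l" for l by (simp add: power2_eq_square flip: power_mult_distrib)
  ultimately show ?thesis by simp
qed

theorem theorem1p1:
  fixes M :: "'a measure" and mu :: "real measure"
    and w :: "(int ^ 'n) set \<Rightarrow> 'a \<Rightarrow> real"
    and g :: "real \<Rightarrow> real"
  assumes dim: "CARD('n) \<ge> 2"
    and prob: "prob_space M"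
    and indep: "prob_space.indep_vars M (\<lambda>_. borel) w (lattice_edges :: (int ^ 'n) set set)"
    and law: "\<forall>e\<in>(lattice_edges :: (int ^ 'n) set set). distr M borel (w e) = mu"
    and pos: "\<forall>e\<in>(lattice_edges :: (int ^ 'n) set set). \<forall>\<omega>\<in>space M. w e \<omega> > 0"
    and g_pos: "\<forall>u>0. g u > 0"
    and g_mono: "\<forall>u v. 0 < u \<longrightarrow> u \<le> v \<longrightarrow> g v \<le> g u"
    and g_lim: "(g \<longlongrightarrow> 0) at_top"
    and cases: "(\<exists>rho < -2. regularly_varying g rho) \<or>
                ((\<exists>U. \<forall>u v. U \<le> u \<longrightarrow> u \<le> v \<longrightarrow> v^2 * g v \<le> u^2 * g u)
                  \<and> ((\<lambda>u. u^2 * g u) \<longlongrightarrow> 0) at_top)"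
    and Lam: "((\<lambda>u. Lambda_g TYPE('n) mu g u / ln (ln u)) \<longlongrightarrow> 0) at_top"
  shows "AE \<omega> in M.
           limsup (\<lambda>n. ereal (principal_eigenvalue (\<lambda>e. w e \<omega>) n / g (real n))) = \<infinity>"
proof -
  interpret prob_space M by (rule prob)
  define edge :: "(int ^ 'n) \<times> 'n \<Rightarrow> (int ^ 'n) set" where "edge = (\<lambda>(v, k). {v, v + axis k 1})"
  define W where "W e = w (edge e)" for e
  define F where "F s = measure mu {..s}" for s
  have edge: "edge e \<in> lattice_edges" for e
    using lattice_adj_step by (auto simp: edge_def lattice_edges_def split: prod.split)
  obtain i i' :: 'n where axes: "i \<noteq> i'"
    using dim by (metis (full_types) UNIV_I card_2_iff' card_le_Suc0_iff_eq finite not_less_eq_eq numeral_2_eq_2)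
  have rv: "w (edge e) \<in> borel_measurable M" for e
    using indep edge unfolding indep_vars_def by blast
  have W_indep: "indep_vars (\<lambda>_. borel) W UNIV"
    unfolding W_def
  proof (rule indep_vars_reindex)
    show "inj edge" unfolding edge_def by (rule inj_edge)
    show "indep_vars (\<lambda>_. borel) w (range edge)" by (rule indep_vars_subset[OF indep]) (use edge in auto)
  qed
  have W_cdf: "prob {\<omega> \<in> space M. W e \<omega> \<le> s} = F s" for e s
  proof -
    have "F s = measure (distr M borel (w (edge e))) {..s}" using law edge by (simp add: F_def)
    also have "\<dots> = prob (w (edge e) -` {..s} \<inter> space M)" by (rule measure_distr[OF rv]) simp
    also have "w (edge e) -` {..s} \<inter> space M = {\<omega> \<in> space M. W e \<omega> \<le> s}" by (auto simp: W_def)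
    finally show ?thesis by simp
  qed
  obtain L where L: "\<And>l. L \<le> l \<Longrightarrow> 4 * g (2 ^ Suc l) \<le> g (2 ^ l)"
    using dyadic_decay[OF g_pos cases] unfolding eventually_sequentially by blast
  have density: "eventually (\<lambda>l. (2 ^ l) ^ CARD('n) * F (g (2 ^ l)) ^ (2 * CARD('n)) \<le> \<epsilon> * ln (real l)) sequentially"
    if \<epsilon>: "\<epsilon> > 0" for \<epsilon>
  proof -
    have "((\<lambda>l. Lambda_g TYPE('n) mu g (2 ^ l) / ln (ln (2 ^ l))) \<longlongrightarrow> 0) sequentially"
      by (rule filterlim_compose[OF Lam filterlim_power2_at_top])
    then have "eventually (\<lambda>l. Lambda_g TYPE('n) mu g (2 ^ l) / ln (ln (2 ^ l)) < \<epsilon>) sequentially"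
      by (rule order_tendstoD) (rule \<epsilon>)
    moreover have "eventually (\<lambda>l::nat. 0 < ln (ln ((2::real) ^ l))) sequentially" by real_asymp
    ultimately show ?thesis using eventually_ge_at_top[of 1]
    proof eventually_elim
      case (elim l)
      have "Lambda_g TYPE('n) mu g (2 ^ l) \<le> \<epsilon> * ln (ln (2 ^ l))" using elim by (simp add: field_simps)
      also have "ln (ln ((2::real) ^ l)) = ln (real l * ln 2)" by (simp add: ln_realpow)
      \<comment> \<open>Since \<open>ln 2 < 1\<close>, the iterated logarithm of
        \<open>2 ^ l\<close> is at most \<open>ln l\<close>.\<close>
      also have "\<epsilon> * ln (real l * ln 2) \<le> \<epsilon> * ln (real l)"
        using elim(3) \<epsilon> ln_2_less_1 by (intro mult_left_mono) (auto simp: ln_mult)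
      finally show ?case by (simp add: Lambda_g_def F_def)
    qed
  qed
  interpret dyadic_weights M W F "\<lambda>l. g (2 ^ l)" L i i'
  proof unfold_locales
    show "indep_vars (\<lambda>_. borel) W UNIV" by (rule W_indep)
    show "W e \<omega> > 0" if "\<omega> \<in> space M" for e \<omega> using pos edge that by (simp add: W_def)
  qed (use W_cdf dim axes g_pos L density dyadic_decay[OF g_pos cases] in auto)
  \<comment> \<open>The exceptional null set must not depend on the constant, so \<open>c\<close>
    ranges over naturals. The 2 offsets the halving in \<open>principal_eigenvalue_ge\<close>, and
    the added 1 keeps the constant positive at \<open>c = 0\<close>.\<close>
  have "AE \<omega> in M. \<forall>c. \<forall>K. \<exists>N\<ge>K. \<forall>f. (\<forall>x. x \<notin> cube (2 ^ N) 0 \<longrightarrow> f x = (0::real)) \<longrightarrow>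
    (\<exists>S. finite S \<and> 2 * (real c + 1) * g (2 ^ N) * (\<Sum>x\<in>cube (2 ^ N) 0. (f x)\<^sup>2) \<le> (\<Sum>e\<in>S. edge_energy (\<lambda>e. W e \<omega>) f e))"
    by (subst AE_all_countable, rule allI, rule energy_large_infinitely_often) simp
  then show ?thesis using AE_space
  proof eventually_elim
    case (elim \<omega>)
    define \<Lambda> where "\<Lambda> n = principal_eigenvalue (\<lambda>e. w e \<omega>) n / g (real n)" for n
    have large: "\<exists>n\<ge>K. \<Lambda> n \<ge> real c" for c K
    proof -
      obtain N where N: "N \<ge> K" and b: "\<And>f. (\<forall>x. x \<notin> cube (2 ^ N) 0 \<longrightarrow> f x = (0::real)) \<Longrightarrow>
        (\<exists>S. finite S \<and> 2 * (real c + 1) * g (2 ^ N) * (\<Sum>x\<in>cube (2 ^ N) 0. (f x)\<^sup>2) \<le> (\<Sum>e\<in>S. edge_energy (\<lambda>e. W e \<omega>) f e))"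
        using elim(1) by blast
      have W_eq: "(\<lambda>e. W e \<omega>) = (\<lambda>(v, k). w {v, v + axis k 1} \<omega>)"
        by (auto simp: W_def edge_def)
      have "2 * (real c + 1) * g (2 ^ N) / 2 \<le> principal_eigenvalue (\<lambda>e. w e \<omega>) (2 ^ N)"
        by (rule principal_eigenvalue_ge) (use pos elim(2) b in \<open>auto simp: W_eq less_imp_le\<close>)
      moreover have "g (2 ^ N) > 0" using g_pos by simp
      ultimately have "real c + 1 \<le> \<Lambda> (2 ^ N)" by (simp add: \<Lambda>_def field_simps)
      moreover have "K \<le> 2 ^ N" using N less_exp[of N] by linarith
      ultimately show ?thesis by (intro exI[of _ "2 ^ N"]) auto
    qed
    have "ereal B \<le> limsup (\<lambda>n. ereal (\<Lambda> n))" for B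
      unfolding limsup_INF_SUP
    proof (rule INF_greatest)
      fix K :: nat
      obtain c where c: "B \<le> real c" using real_arch_simple by blast
      obtain n where "n \<ge> K" "\<Lambda> n \<ge> real c" using large by blast
      then show "ereal B \<le> (SUP m\<in>{K..}. ereal (\<Lambda> m))" using c by (intro SUP_upper2[of n]) auto
    qed
    then show ?case unfolding \<Lambda>_def by (rule ereal_top)
  qed
qed

end
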